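(* Let $\mathbf{k}$ be a field of characteristic zero, let $F_1,\dots,F_n\in\mathbf{k}[[\partial_1,\dots,\partial_n]]$ be formal power series, where $\partial_i=\partial/\partial x_i$, and let $\mu,q_1,\dots,q_n$ be formal commuting variables. Let $K=(K_1,\dots,K_n)$, $K_j=K_j(\mu,q)\in\mathbf{k}[[\mu,q_1,\dots,q_n]]$ with zero constant term, be determined by $$e^{\sum_jK_j(\mu,q)x_j}=e^{\mu\sum_ix_iF_i(\partial)}\Bigl(e^{\sum_jq_jx_j}\Bigr).$$ Let $\mathcal{O}(q)=\sum_{i=1}^nF_i(q)\frac{\partial}{\partial q_i}$. Then for $i=1,\dots,n$ $$K_i(\mu,q)=q_i+\frac{\exp(\mu\,\mathcal{O}(q))-1}{\mathcal{O}(q)}\,F_i(q).$$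
   Context: The operators $x_i$ (multiplication) and $\partial_i$ (differentiation) act on $\mathbf{k}[x_1,\dots,x_n]$; a formal power series in the $\partial_i$ acts on a polynomial through finitely many terms. The action is extended coefficientwise to $\mathbf{k}[x_1,\dots,x_n][[\mu,q_1,\dots,q_n]]$, and $e^{\mu\sum_ix_iF_i(\partial)}=\sum_{m\geq0}\frac{\mu^m}{m!}\bigl(\sum_ix_iF_i(\partial)\bigr)^m$. $F_i(q)$ denotes substitution of $q=(q_1,\dots,q_n)$ for $(\partial_1,\dots,\partial_n)$. The operator $\mathcal{O}(q)$ acts on $\mathbf{k}[[q_1,\dots,q_n]]$, and $\frac{\exp(\mu\mathcal{O})-1}{\mathcal{O}}$ denotes the formal series of operators $\sum_{l\geq1}\frac{\mu^l}{l!}\mathcal{O}^{l-1}$. *)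

theory Defs
  imports Complex_Main "HOL-Library.Poly_Mapping"
begin

section \<open>Polynomials\<close>

text \<open>Polynomials over \<open>'a\<close> in variables indexed by \<open>'v\<close>; a monomial is its finitely
  supported exponent vector.\<close>

type_synonym ('v, 'a) mpoly = "('v \<Rightarrow>\<^sub>0 nat) \<Rightarrow>\<^sub>0 'a"

definition mpoly_const :: "'a::zero \<Rightarrow> ('v, 'a) mpoly"
  where "mpoly_const c = Poly_Mapping.single 0 c"

definition mpoly_var :: "'v \<Rightarrow> ('v, 'a::zero_neq_one) mpoly"
  where "mpoly_var i = Poly_Mapping.single (Poly_Mapping.single i 1) 1"

text \<open>Subtraction of exponents is truncated, but then the coefficient
  \<open>lookup a i\<close> vanishes.\<close>

definition mpoly_diff :: "'v \<Rightarrow> ('v, 'a::comm_semiring_1) mpoly \<Rightarrow> ('v, 'a) mpoly"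
  where "mpoly_diff i p =
    (\<Sum>a\<in>Poly_Mapping.keys p. Poly_Mapping.single (a - Poly_Mapping.single i 1)
        (of_nat (Poly_Mapping.lookup a i) * Poly_Mapping.lookup p a))"

text \<open>The iterated derivative \<open>\<partial>\<^sup>a = \<Prod>\<^sub>i \<partial>\<^sub>i ^ a\<^sub>i\<close>; the order of the factors is irrelevant
  (see \<open>comp_fun_commute_mpoly_diff\<close>).\<close>

definition mpoly_diffs :: "('v \<Rightarrow>\<^sub>0 nat) \<Rightarrow> ('v, 'a::comm_semiring_1) mpoly \<Rightarrow> ('v, 'a) mpoly"
  where "mpoly_diffs a p =
    Finite_Set.fold (\<lambda>i. mpoly_diff i ^^ Poly_Mapping.lookup a i) p (Poly_Mapping.keys a)"

lemma lookup_mpoly_diff: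
  "Poly_Mapping.lookup (mpoly_diff i p) b =
     of_nat (Poly_Mapping.lookup b i + 1) * Poly_Mapping.lookup p (b + Poly_Mapping.single i 1)"
proof -
  let ?e = "Poly_Mapping.single i (1::nat)"
  let ?t = "\<lambda>a. of_nat (Poly_Mapping.lookup a i) * Poly_Mapping.lookup p a"
  have *: "Poly_Mapping.lookup (Poly_Mapping.single (a - ?e) (?t a)) b =
      (if a = b + ?e then ?t a else 0)" for a
  proof (cases "Poly_Mapping.lookup a i = 0")
    case True
    then have "a \<noteq> b + ?e"
      by (metis add_eq_0_iff_both_eq_0 lookup_add lookup_single_eq one_neq_zero)
    with True show ?thesis by simp
  next
    case False
    have "a - ?e = b \<longleftrightarrow> a = b + ?e"
    proof
      assume "a - ?e = b"
      have "a = (a - ?e) + ?e"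
        using False
        by (intro poly_mapping_eqI) (auto simp: lookup_add lookup_minus lookup_single when_def)
      then show "a = b + ?e" using \<open>a - ?e = b\<close> by simp
    qed simp
    then show ?thesis by (auto simp: lookup_single when_def)
  qed
  have "Poly_Mapping.lookup (mpoly_diff i p) b =
      (\<Sum>a\<in>Poly_Mapping.keys p. if a = b + ?e then ?t a else 0)"
    unfolding mpoly_diff_def lookup_sum by (simp only: *)
  also have "\<dots> = ?t (b + ?e)"
    by (auto simp: sum.delta in_keys_iff)
  finally show ?thesis by (simp add: lookup_add)
qed

lemma mpoly_diff_commute: "mpoly_diff i (mpoly_diff j p) = mpoly_diff j (mpoly_diff i p)"
  by (cases "i = j"; intro poly_mapping_eqI)
    (auto simp: lookup_mpoly_diff lookup_add lookup_single when_def algebra_simps)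

lemma comp_fun_commute_mpoly_diff: "comp_fun_commute (\<lambda>i. mpoly_diff i ^^ f i)"
proof
  have *: "mpoly_diff i ((mpoly_diff j ^^ n) p) = (mpoly_diff j ^^ n) (mpoly_diff i p)" for i j n p
    by (induction n) (simp_all add: mpoly_diff_commute [of i j])
  have "(mpoly_diff i ^^ m) ((mpoly_diff j ^^ n) p) = (mpoly_diff j ^^ n) ((mpoly_diff i ^^ m) p)"
    for i j m n p
    by (induction m) (simp_all add: *)
  then show "(mpoly_diff j ^^ f j) \<circ> (mpoly_diff i ^^ f i) =
      (mpoly_diff i ^^ f i) \<circ> (mpoly_diff j ^^ f j)" for i j
    by (intro ext) (simp only: o_apply)
qed


section \<open>Formal power series in several variables\<close>

text \<open>\<open>('v, 'a) mfps\<close> is the ring of formal power series over \<open>'a\<close> in variables indexed by \<open>'v\<close>.\<close>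

typedef ('v, 'a) mfps = "UNIV :: (('v \<Rightarrow>\<^sub>0 nat) \<Rightarrow> 'a) set"
  morphisms mfps_coeff Abs_mfps ..

lemma mfps_coeff_Abs [simp]: "mfps_coeff (Abs_mfps f) = f"
  by (simp add: Abs_mfps_inverse)

lemma mfps_eqI: "(\<And>a. mfps_coeff f a = mfps_coeff g a) \<Longrightarrow> f = g"
  by (simp add: mfps_coeff_inject [symmetric] fun_eq_iff)

lemma finite_below_monomial:
  fixes c :: "'v \<Rightarrow>\<^sub>0 nat"
  shows "finite {a. \<exists>b. a + b = c}"
proof -
  let ?K = "Poly_Mapping.keys c"
  let ?T = "\<Union>v\<in>?K. {..Poly_Mapping.lookup c v}"
  let ?S = "{f. \<forall>v. (v \<in> ?K \<longrightarrow> f v \<in> ?T) \<and> (v \<notin> ?K \<longrightarrow> f v = 0)}"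
  have "finite ?S"
    by (rule finite_set_of_finite_funs) auto
  moreover have "Poly_Mapping.lookup a \<in> ?S" if "a + b = c" for a b
  proof -
    have le: "Poly_Mapping.lookup a v \<le> Poly_Mapping.lookup c v" for v
      using that by (auto simp: lookup_add)
    show ?thesis
    proof (intro CollectI allI conjI impI)
      fix v assume "v \<in> ?K"
      then show "Poly_Mapping.lookup a v \<in> ?T" using le by blast
    next
      fix v assume "v \<notin> ?K"
      then have "Poly_Mapping.lookup c v = 0" by (simp add: in_keys_iff)
      then show "Poly_Mapping.lookup a v = 0" using le [of v] by simp
    qed
  qed
  then have "Poly_Mapping.lookup ` {a. \<exists>b. a + b = c} \<subseteq> ?S"
    by (intro image_subsetI) (elim CollectE exE)
  ultimately have "finite (Poly_Mapping.lookup ` {a. \<exists>b. a + b = c})"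
    using finite_subset by blast
  then show ?thesis
    by (rule finite_imageD) (simp add: inj_on_def)
qed

lemma finite_split_monomial:
  fixes c :: "'v \<Rightarrow>\<^sub>0 nat"
  shows "finite {(a, b). a + b = c}"
proof (rule finite_subset)
  show "{(a, b). a + b = c} \<subseteq> {a. \<exists>b. a + b = c} \<times> {a. \<exists>b. a + b = c}"
    by clarsimp (metis add.commute)
qed (intro finite_cartesian_product finite_below_monomial)

instantiation mfps :: (type, comm_ring_1) comm_ring_1
begin

definition "0 = Abs_mfps (\<lambda>_. 0)"
definition "1 = Abs_mfps (\<lambda>a. if a = 0 then 1 else 0)"
definition "f + g = Abs_mfps (\<lambda>a. mfps_coeff f a + mfps_coeff g a)"
definition "f - g = Abs_mfps (\<lambda>a. mfps_coeff f a - mfps_coeff g a)"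
definition "- f = Abs_mfps (\<lambda>a. - mfps_coeff f a)"
definition "f * g = Abs_mfps (\<lambda>c. \<Sum>(a, b) | a + b = c. mfps_coeff f a * mfps_coeff g b)"

instance
proof
  fix f g h :: "('a, 'b) mfps"
  show "f * g * h = f * (g * h)"
  proof (rule mfps_eqI)
    fix d :: "'a \<Rightarrow>\<^sub>0 nat"
    have fin: "finite {p. fst p + snd p = c}" for c :: "'a \<Rightarrow>\<^sub>0 nat"
      using finite_split_monomial [of c] by (simp add: case_prod_unfold)
    let ?f = "mfps_coeff f" and ?g = "mfps_coeff g" and ?h = "mfps_coeff h"
    let ?L = "SIGMA (u, c):{(u, c). u + c = d}. {(a, b). a + b = u}"
    let ?R = "SIGMA (a, v):{(a, v). a + v = d}. {(b, c). b + c = v}"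
    have "mfps_coeff (f * g * h) d =
        (\<Sum>(u, c) | u + c = d. \<Sum>(a, b) | a + b = u. ?f a * ?g b * ?h c)"
      by (simp add: times_mfps_def sum_distrib_right case_prod_unfold)
    also have "\<dots> = (\<Sum>((u, c), (a, b))\<in>?L. ?f a * ?g b * ?h c)"
      using sum.Sigma [of "{(u, c). u + c = d}" "\<lambda>(u, c). {(a, b). a + b = u}"
          "\<lambda>(u, c) (a, b). ?f a * ?g b * ?h c"]
      by (simp add: fin case_prod_unfold)
    also have "\<dots> = (\<Sum>((a, v), (b, c))\<in>?R. ?f a * (?g b * ?h c))"
      by (rule sum.reindex_bij_witness
          [of _ "\<lambda>((a, v), (b, c)). ((a + b, c), (a, b))" "\<lambda>((u, c), (a, b)). ((a, b + c), (b, c))"])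
        (auto simp: algebra_simps)
    also have "\<dots> = (\<Sum>(a, v) | a + v = d. \<Sum>(b, c) | b + c = v. ?f a * (?g b * ?h c))"
      using sum.Sigma [of "{(a, v). a + v = d}" "\<lambda>(a, v). {(b, c). b + c = v}"
          "\<lambda>(a, v) (b, c). ?f a * (?g b * ?h c)"]
      by (simp add: fin case_prod_unfold)
    also have "\<dots> = mfps_coeff (f * (g * h)) d"
      by (simp add: times_mfps_def sum_distrib_left case_prod_unfold)
    finally show "mfps_coeff (f * g * h) d = mfps_coeff (f * (g * h)) d" .
  qed
  show "f * g = g * f"
    unfolding times_mfps_def
    by (intro arg_cong [of _ _ Abs_mfps] ext sum.reindex_bij_witness [of _ prod.swap prod.swap])
      (auto simp: algebra_simps)
  show "1 * f = f"
  proof (rule mfps_eqI)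
    fix c
    have "mfps_coeff (1 * f) c = (\<Sum>(a, b)\<in>{(0, c)}. mfps_coeff 1 a * mfps_coeff f b)"
      unfolding times_mfps_def mfps_coeff_Abs
      by (rule sum.mono_neutral_right [OF finite_split_monomial])
        (auto simp: one_mfps_def split: if_splits)
    then show "mfps_coeff (1 * f) c = mfps_coeff f c"
      by (simp add: one_mfps_def)
  qed
  show "(f + g) * h = f * h + g * h"
    by (simp add: times_mfps_def plus_mfps_def case_prod_unfold distrib_right sum.distrib)
  have "mfps_coeff (0 :: ('a, 'b) mfps) 0 \<noteq> mfps_coeff 1 0"
    by (simp add: zero_mfps_def one_mfps_def)
  then show "(0 :: ('a, 'b) mfps) \<noteq> 1"
    by metis
qed (auto simp: zero_mfps_def plus_mfps_def minus_mfps_def uminus_mfps_def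
    mfps_coeff_inverse algebra_simps)

end

definition mfps_const :: "'a::zero \<Rightarrow> ('v, 'a) mfps"
  where "mfps_const c = Abs_mfps (\<lambda>a. if a = 0 then c else 0)"

definition mfps_var :: "'v \<Rightarrow> ('v, 'a::zero_neq_one) mfps"
  where "mfps_var v = Abs_mfps (\<lambda>a. if a = Poly_Mapping.single v 1 then 1 else 0)"

definition mfps_diff :: "'v \<Rightarrow> ('v, 'a::comm_semiring_1) mfps \<Rightarrow> ('v, 'a) mfps"
  where "mfps_diff i f =
    Abs_mfps (\<lambda>a. of_nat (Poly_Mapping.lookup a i + 1) * mfps_coeff f (a + Poly_Mapping.single i 1))"

definition mfps_map :: "('a \<Rightarrow> 'b) \<Rightarrow> ('v, 'a) mfps \<Rightarrow> ('v, 'b) mfps"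
  where "mfps_map h f = Abs_mfps (\<lambda>a. h (mfps_coeff f a))"

text \<open>Infinite sums of series are formed coefficientwise. In all uses below, only finitely many
  terms contribute to each coefficient (otherwise \<^term>\<open>Sum_any\<close> would return \<open>0\<close>).\<close>

definition mfps_suminf :: "(nat \<Rightarrow> ('v, 'a::comm_monoid_add) mfps) \<Rightarrow> ('v, 'a) mfps"
  where "mfps_suminf g = Abs_mfps (\<lambda>a. Sum_any (\<lambda>m. mfps_coeff (g m) a))"


section \<open>The variables \<open>\<mu>, q\<^sub>1, \<dots>, q\<^sub>n\<close>\<close>

text \<open>The index type \<open>'n\<close> plays the role of \<open>{1, \<dots>, n}\<close>. The rings involved are
  \<^item> \<open>('n, 'a) mfps\<close> for \<open>k[[\<partial>\<^sub>1, \<dots>, \<partial>\<^sub>n]]\<close> and \<open>k[[q\<^sub>1, \<dots>, q\<^sub>n]]\<close>, so that \<open>F\<^sub>i(q)\<close> is \<open>F i\<close> itself;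
  \<^item> \<open>('n pvar, 'a) mfps\<close> for \<open>k[[\<mu>, q\<^sub>1, \<dots>, q\<^sub>n]]\<close>;
  \<^item> \<open>('n pvar, ('n, 'a) mpoly) mfps\<close> for \<open>k[x\<^sub>1, \<dots>, x\<^sub>n][[\<mu>, q\<^sub>1, \<dots>, q\<^sub>n]]\<close>.\<close>

datatype 'n pvar = Mu | Q 'n

abbreviation mu :: "('n pvar, 'a::zero_neq_one) mfps"
  where "mu \<equiv> mfps_var Mu"

abbreviation q_var :: "'n \<Rightarrow> ('n pvar, 'a::zero_neq_one) mfps"
  where "q_var i \<equiv> mfps_var (Q i)"

text \<open>The inclusion of \<open>k[[q]]\<close> into \<open>k[[\<mu>, q]]\<close>.\<close>

definition lift_q :: "('n, 'a::zero) mfps \<Rightarrow> ('n pvar, 'a) mfps"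
  where "lift_q f = Abs_mfps (\<lambda>a. if Poly_Mapping.lookup a Mu = 0
      then mfps_coeff f (Poly_Mapping.map_key Q a) else 0)"

text \<open>The inclusion of \<open>k[[\<mu>, q]]\<close> into \<open>k[x][[\<mu>, q]]\<close>.\<close>

definition lift_x :: "('n pvar, 'a::zero) mfps \<Rightarrow> ('n pvar, ('n, 'a) mpoly) mfps"
  where "lift_x = mfps_map mpoly_const"

definition x_var :: "'n \<Rightarrow> ('n pvar, ('n, 'a::zero_neq_one) mpoly) mfps"
  where "x_var i = mfps_const (mpoly_var i)"

definition scalar :: "'a::zero \<Rightarrow> ('n pvar, ('n, 'a) mpoly) mfps"
  where "scalar c = mfps_const (mpoly_const c)"

text \<open>The exponential of a series with zero constant term.\<close>

definition mfps_exp ::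
    "('n pvar, ('n, 'a::field_char_0) mpoly) mfps \<Rightarrow> ('n pvar, ('n, 'a) mpoly) mfps"
  where "mfps_exp f = mfps_suminf (\<lambda>m. scalar (1 / fact m) * f ^ m)"


section \<open>The operators\<close>

text \<open>The action of \<open>G(\<partial>)\<close> on a polynomial; only finitely many terms are nonzero.\<close>

definition diff_op :: "('n, 'a::comm_ring_1) mfps \<Rightarrow> ('n, 'a) mpoly \<Rightarrow> ('n, 'a) mpoly"
  where "diff_op G p = Sum_any (\<lambda>a. mpoly_const (mfps_coeff G a) * mpoly_diffs a p)"

definition xF_op ::
    "('n::finite \<Rightarrow> ('n, 'a::comm_ring_1) mfps) \<Rightarrow> ('n, 'a) mpoly \<Rightarrow> ('n, 'a) mpoly"
  where "xF_op F p = (\<Sum>i\<in>UNIV. mpoly_var i * diff_op (F i) p)"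

text \<open>\<open>exp (\<mu> A)\<close> for an operator \<open>A\<close> on polynomials, extended coefficientwise to series.\<close>

definition exp_mu_op ::
    "(('n, 'a::field_char_0) mpoly \<Rightarrow> ('n, 'a) mpoly) \<Rightarrow>
      ('n pvar, ('n, 'a) mpoly) mfps \<Rightarrow> ('n pvar, ('n, 'a) mpoly) mfps"
  where "exp_mu_op A f =
    mfps_suminf (\<lambda>m. scalar (1 / fact m) * mu ^ m * (mfps_map A ^^ m) f)"

definition O_op :: "('n::finite \<Rightarrow> ('n, 'a::comm_ring_1) mfps) \<Rightarrow> ('n, 'a) mfps \<Rightarrow> ('n, 'a) mfps"
  where "O_op F g = (\<Sum>i\<in>UNIV. F i * mfps_diff i g)"

text \<open>\<open>(exp (\<mu> T) - 1) / T = \<Sum>\<^sub>l\<^sub>\<ge>\<^sub>1 \<mu>\<^sup>l / l! T\<^sup>l\<^sup>-\<^sup>1\<close> for an operator \<open>T\<close> on \<open>k[[q]]\<close>; the summation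
  index is shifted by one.\<close>

definition expm1_div_op ::
    "(('n, 'a::field_char_0) mfps \<Rightarrow> ('n, 'a) mfps) \<Rightarrow> ('n, 'a) mfps \<Rightarrow> ('n pvar, 'a) mfps"
  where "expm1_div_op T g =
    mfps_suminf (\<lambda>l. mfps_const (1 / fact (Suc l)) * mu ^ Suc l * lift_q ((T ^^ l) g))"

definition determines_K ::
    "('n::finite \<Rightarrow> ('n, 'a::field_char_0) mfps) \<Rightarrow> ('n \<Rightarrow> ('n pvar, 'a) mfps) \<Rightarrow> bool"
  where "determines_K F K \<longleftrightarrow>
    (\<forall>j. mfps_coeff (K j) 0 = 0) \<and>
    mfps_exp (\<Sum>j\<in>UNIV. lift_x (K j) * x_var j) =
      exp_mu_op (xF_op F) (mfps_exp (\<Sum>j\<in>UNIV. q_var j * x_var j))"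

end

theory Submission
  imports Defs
begin

text \<open>Write \<open>E = e\<^sup>q\<^sup>x\<close>, \<open>A = \<Sum>\<^sub>i x\<^sub>i F\<^sub>i(\<partial>)\<close> and \<open>B = \<Sum>\<^sub>i F\<^sub>i(q) \<partial>/\<partial>q\<^sub>i\<close>. Since \<open>F\<^sub>i(\<partial>) E = F\<^sub>i(q) E\<close> and
  \<open>x\<^sub>i E = \<partial>E/\<partial>q\<^sub>i\<close>, we have \<open>A E = B E\<close>; as \<open>A\<close> acts on \<open>x\<close> and \<open>B\<close> on \<open>q\<close>, they commute, so that
  \<open>G = exp (\<mu> A) E\<close> solves \<open>\<partial>G/\<partial>\<mu> = B G\<close> with \<open>G = E\<close> at \<open>\<mu> = 0\<close>. The series
  \<open>K\<^sub>j = exp (\<mu> B) q\<^sub>j\<close> solve the same equation, hence so does the exponential of \<open>\<Sum>\<^sub>j K\<^sub>j x\<^sub>j\<close>, because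
  \<open>B\<close> is a derivation that annihilates the \<open>x\<^sub>j\<close>. A solution is determined by its value at \<open>\<mu> = 0\<close>.
  Conversely, \<open>K\<^sub>j\<close> can be read off the exponential as its coefficient of the monomial \<open>x\<^sub>j\<close>.\<close>


section \<open>Coefficients\<close>

lemma mfps_coeff_zero [simp]: "mfps_coeff 0 a = 0"
  by (simp add: zero_mfps_def)

lemma mfps_coeff_one: "mfps_coeff 1 a = (if a = 0 then 1 else 0)"
  by (simp add: one_mfps_def)

lemma mfps_coeff_add [simp]: "mfps_coeff (f + g) a = mfps_coeff f a + mfps_coeff g a"
  by (simp add: plus_mfps_def)

lemma mfps_coeff_diff [simp]: "mfps_coeff (f - g) a = mfps_coeff f a - mfps_coeff g a"
  by (simp add: minus_mfps_def)

lemma mfps_coeff_sum [simp]: "mfps_coeff (sum f S) a = (\<Sum>s\<in>S. mfps_coeff (f s) a)"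
  by (induction S rule: infinite_finite_induct) simp_all

lemma mfps_coeff_mult:
  "mfps_coeff (f * g) c = (\<Sum>(a, b) | a + b = c. mfps_coeff f a * mfps_coeff g b)"
  by (simp add: times_mfps_def)

lemma mfps_coeff_const: "mfps_coeff (mfps_const c) a = (if a = 0 then c else 0)"
  by (simp add: mfps_const_def)

lemma mfps_coeff_var: "mfps_coeff (mfps_var v) a = (if a = Poly_Mapping.single v 1 then 1 else 0)"
  by (simp add: mfps_var_def)

lemma mfps_coeff_map [simp]: "mfps_coeff (mfps_map h f) a = h (mfps_coeff f a)"
  by (simp add: mfps_map_def)

lemma mfps_coeff_mfps_diff:
  "mfps_coeff (mfps_diff i f) a =
    of_nat (Poly_Mapping.lookup a i + 1) * mfps_coeff f (a + Poly_Mapping.single i 1)"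
  by (simp add: mfps_diff_def)

lemma mfps_coeff_suminf:
  "mfps_coeff (mfps_suminf g) a = Sum_any (\<lambda>m. mfps_coeff (g m) a)"
  by (simp add: mfps_suminf_def)

lemma mfps_coeff_const_mult [simp]:
  fixes f :: "('v, 'a::comm_ring_1) mfps"
  shows "mfps_coeff (mfps_const c * f) a = c * mfps_coeff f a"
proof -
  have "mfps_coeff (mfps_const c * f) a =
      (\<Sum>(x, b)\<in>{(0, a)}. mfps_coeff (mfps_const c :: ('v, 'a) mfps) x * mfps_coeff f b)"
    unfolding mfps_coeff_mult
    by (rule sum.mono_neutral_right [OF finite_split_monomial])
      (auto simp: mfps_coeff_const split: if_splits)
  then show ?thesis by (simp add: mfps_coeff_const)
qed

lemma mfps_const_zero [simp]: "mfps_const 0 = 0"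
  by (rule mfps_eqI) (simp add: mfps_coeff_const)

lemma mfps_const_one [simp]: "mfps_const 1 = 1"
  by (rule mfps_eqI) (simp add: mfps_coeff_const mfps_coeff_one)

lemma mfps_const_add: "mfps_const (c + d) = mfps_const c + mfps_const (d::'a::comm_ring_1)"
  by (rule mfps_eqI) (simp add: mfps_coeff_const)

lemma mfps_const_mult: "mfps_const (c * d) = mfps_const c * mfps_const (d::'a::comm_ring_1)"
  by (rule mfps_eqI) (simp add: mfps_coeff_const)

lemma mfps_const_of_nat: "mfps_const (of_nat n) = (of_nat n :: (_, 'a::comm_ring_1) mfps)"
  by (induction n) (simp_all add: mfps_const_add)

section \<open>Monomials as power series\<close>

definition mfps_monom :: "('v \<Rightarrow>\<^sub>0 nat) \<Rightarrow> ('v, 'a::zero_neq_one) mfps"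
  where "mfps_monom a = Abs_mfps (\<lambda>b. if b = a then 1 else 0)"

lemma mfps_coeff_monom: "mfps_coeff (mfps_monom a) b = (if b = a then 1 else 0)"
  by (simp add: mfps_monom_def)

text \<open>Exponents cancel, so the sum has at most one term; its form avoids a case distinction on
  whether \<open>a\<close> divides \<open>c\<close>.\<close>

lemma mfps_coeff_monom_mult:
  "mfps_coeff (mfps_monom a * f) c = (\<Sum>b | a + b = c. mfps_coeff f b)"
proof -
  let ?S = "{(x, b). x + b = c \<and> x = a}"
  have "mfps_coeff (mfps_monom a * f) c = (\<Sum>(x, b)\<in>?S. mfps_coeff f b)"
    unfolding mfps_coeff_mult
    by (rule sum.mono_neutral_cong_right [OF finite_split_monomial])
      (auto simp: mfps_coeff_monom split: if_splits)
  also have "\<dots> = (\<Sum>b | a + b = c. mfps_coeff f b)"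
    by (rule sum.reindex_bij_witness [of _ "\<lambda>b. (a, b)" snd]) auto
  finally show ?thesis .
qed

lemma mfps_var_eq_monom: "mfps_var v = mfps_monom (Poly_Mapping.single v 1)"
  by (rule mfps_eqI) (simp add: mfps_coeff_var mfps_coeff_monom)

lemma mfps_one_eq_monom: "1 = mfps_monom 0"
  by (rule mfps_eqI) (simp add: mfps_coeff_one mfps_coeff_monom)

lemma mfps_monom_mult:
  "mfps_monom a * mfps_monom b = (mfps_monom (a + b) :: ('v, 'a::comm_ring_1) mfps)"
proof (rule mfps_eqI)
  fix c
  have fin: "finite {x. a + x = c}"
    by (rule finite_subset [OF _ finite_below_monomial [of c]]) (auto simp: add.commute)
  have "mfps_coeff (mfps_monom a * mfps_monom b :: ('v, 'a) mfps) c =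
      (\<Sum>x\<in>{x. a + x = c}. if x = b then 1 else 0)"
    by (simp add: mfps_coeff_monom_mult mfps_coeff_monom)
  also have "\<dots> = (if a + b = c then 1 else 0)"
    using fin by simp
  finally show "mfps_coeff (mfps_monom a * mfps_monom b :: ('v, 'a) mfps) c =
      mfps_coeff (mfps_monom (a + b)) c"
    by (auto simp: mfps_coeff_monom)
qed


section \<open>Continuous operators and derivations\<close>

text \<open>The condition under which \<open>mfps_suminf\<close> is a genuine sum, since
  \<open>Sum_any\<close> defaults to 0 on an infinite support.\<close>

definition locally_finite :: "(nat \<Rightarrow> ('v, 'a::zero) mfps) \<Rightarrow> bool"
  where "locally_finite g \<longleftrightarrow> (\<forall>a. finite {m. mfps_coeff (g m) a \<noteq> 0})"

lemma mfps_coeff_suminf_superset: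
  assumes "finite M" "{m. mfps_coeff (g m) a \<noteq> 0} \<subseteq> M"
  shows "mfps_coeff (mfps_suminf g) a = (\<Sum>m\<in>M. mfps_coeff (g m) a)"
  unfolding mfps_coeff_suminf using assms by (rule Sum_any.expand_superset)

lemma mfps_suminf_Suc:
  fixes g :: "nat \<Rightarrow> ('v, 'a::comm_ring_1) mfps"
  assumes "locally_finite g"
  shows "mfps_suminf g = g 0 + mfps_suminf (\<lambda>m. g (Suc m))"
proof (rule mfps_eqI)
  fix a
  have "finite {m. mfps_coeff (g m) a \<noteq> 0}"
    using assms by (simp add: locally_finite_def)
  then obtain N where N: "\<And>m. mfps_coeff (g m) a \<noteq> 0 \<Longrightarrow> m \<le> N"
    by (auto simp: finite_nat_set_iff_bounded_le)
  have "mfps_coeff (mfps_suminf g) a = (\<Sum>m\<in>{..<Suc (Suc N)}. mfps_coeff (g m) a)"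
    by (rule mfps_coeff_suminf_superset) (auto dest: N)
  also have "\<dots> = mfps_coeff (g 0) a + (\<Sum>m<Suc N. mfps_coeff (g (Suc m)) a)"
    by (rule sum.lessThan_Suc_shift)
  also have "(\<Sum>m<Suc N. mfps_coeff (g (Suc m)) a) = mfps_coeff (mfps_suminf (\<lambda>m. g (Suc m))) a"
    by (rule mfps_coeff_suminf_superset [symmetric]) (auto dest: N)
  finally show "mfps_coeff (mfps_suminf g) a =
      mfps_coeff (g 0 + mfps_suminf (\<lambda>m. g (Suc m))) a" by simp
qed

text \<open>Additive maps that are continuous for the product topology with discrete coefficients;
  by additivity, continuity at 0 is enough.\<close>

definition mfps_continuous :: "(('v, 'a::comm_ring_1) mfps \<Rightarrow> ('w, 'b::comm_ring_1) mfps) \<Rightarrow> bool"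
  where "mfps_continuous T \<longleftrightarrow> (\<forall>f g. T (f + g) = T f + T g) \<and>
    (\<forall>a. \<exists>S. finite S \<and> (\<forall>f. (\<forall>b\<in>S. mfps_coeff f b = 0) \<longrightarrow> mfps_coeff (T f) a = 0))"

lemma mfps_continuous_add: "mfps_continuous T \<Longrightarrow> T (f + g) = T f + T g"
  by (simp add: mfps_continuous_def)

lemma mfps_continuous_zero:
  assumes "mfps_continuous T"
  shows "T 0 = 0"
  using mfps_continuous_add [OF assms, of 0 0] by simp

lemma mfps_continuous_sum:
  assumes "mfps_continuous T"
  shows "T (sum f S) = (\<Sum>s\<in>S. T (f s))"
  by (induction S rule: infinite_finite_induct)
    (simp_all add: mfps_continuous_add [OF assms] mfps_continuous_zero [OF assms])

text \<open>A fixed coefficient of an image is controlled by finitely many coefficients of the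
  argument, and up to these the infinite sum is a finite one.\<close>

lemma mfps_continuous_suminf:
  assumes T: "mfps_continuous T" and g: "locally_finite g"
  shows "locally_finite (\<lambda>m. T (g m))" (is ?thesis1)
    and "T (mfps_suminf g) = mfps_suminf (\<lambda>m. T (g m))" (is ?thesis2)
proof -
  have *: "\<exists>M. finite M \<and> {m. mfps_coeff (T (g m)) a \<noteq> 0} \<subseteq> M \<and>
      mfps_coeff (T (mfps_suminf g)) a = (\<Sum>m\<in>M. mfps_coeff (T (g m)) a)" for a
  proof -
    obtain S where S: "finite S"
      "\<And>f. (\<And>b. b \<in> S \<Longrightarrow> mfps_coeff f b = 0) \<Longrightarrow> mfps_coeff (T f) a = 0"
      using T unfolding mfps_continuous_def by meson
    \<comment> \<open>The indices of the terms visible in the controlling set \<open>S\<close>.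
      Removing them from the sum leaves a remainder \<open>r\<close> that vanishes on
      \<open>S\<close>.\<close>
    define M where "M = (\<Union>b\<in>S. {m. mfps_coeff (g m) b \<noteq> 0})"
    have M: "finite M"
      using S(1) g by (simp add: M_def locally_finite_def)
    define r where "r = mfps_suminf g - (\<Sum>m\<in>M. g m)"
    have "mfps_coeff r b = 0" if "b \<in> S" for b
    proof -
      have "mfps_coeff (mfps_suminf g) b = (\<Sum>m\<in>M. mfps_coeff (g m) b)"
        using that by (intro mfps_coeff_suminf_superset M) (auto simp: M_def)
      then show ?thesis by (simp add: r_def)
    qed
    then have "mfps_coeff (T r) a = 0" by (rule S(2))
    moreover have "mfps_suminf g = r + (\<Sum>m\<in>M. g m)" by (simp add: r_def)
    ultimately have "mfps_coeff (T (mfps_suminf g)) a = (\<Sum>m\<in>M. mfps_coeff (T (g m)) a)"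
      by (simp add: mfps_continuous_add [OF T] mfps_continuous_sum [OF T])
    moreover have "{m. mfps_coeff (T (g m)) a \<noteq> 0} \<subseteq> M"
    proof
      fix m assume "m \<in> {m. mfps_coeff (T (g m)) a \<noteq> 0}"
      then show "m \<in> M" using S(2) [of "g m"] by (auto simp: M_def)
    qed
    ultimately show ?thesis using M by blast
  qed
  show ?thesis1
    unfolding locally_finite_def using * by (metis finite_subset)
  show ?thesis2
  proof (rule mfps_eqI)
    fix a
    show "mfps_coeff (T (mfps_suminf g)) a = mfps_coeff (mfps_suminf (\<lambda>m. T (g m))) a"
      using * [of a] mfps_coeff_suminf_superset [of _ "\<lambda>m. T (g m)" a] by metis
  qed
qed

lemma mfps_continuousI:
  assumes "\<And>f g. T (f + g) = T f + T g"
    and "\<And>a. finite (S a)"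
    and "\<And>f a. (\<And>b. b \<in> S a \<Longrightarrow> mfps_coeff f b = 0) \<Longrightarrow> mfps_coeff (T f) a = 0"
  shows "mfps_continuous T"
  unfolding mfps_continuous_def using assms by (metis (no_types))

lemma mfps_continuous_mult: "mfps_continuous (\<lambda>f. h * f)"
proof (rule mfps_continuousI)
  show "finite {b. \<exists>x. b + x = a}" for a :: "'a \<Rightarrow>\<^sub>0 nat"
    by (rule finite_below_monomial)
  show "mfps_coeff (h * f) a = 0" if "\<And>b. b \<in> {b. \<exists>x. b + x = a} \<Longrightarrow> mfps_coeff f b = 0" for f a
    unfolding mfps_coeff_mult
  proof (rule sum.neutral, clarify)
    fix x b assume "a = x + b"
    then have "mfps_coeff f b = 0" using that by (metis (mono_tags) add.commute mem_Collect_eq)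
    then show "mfps_coeff h x * mfps_coeff f b = 0" by simp
  qed
qed (simp add: distrib_left)

lemma mfps_continuous_diff: "mfps_continuous (mfps_diff i)"
  by (rule mfps_continuousI [where S = "\<lambda>a. {a + Poly_Mapping.single i 1}"])
    (auto intro!: mfps_eqI simp: mfps_coeff_mfps_diff distrib_left)

lemma mfps_continuous_map:
  fixes h :: "'a::comm_ring_1 \<Rightarrow> 'b::comm_ring_1"
  assumes "\<And>p q. h (p + q) = h p + h q"
  shows "mfps_continuous (mfps_map h)"
proof (rule mfps_continuousI [where S = "\<lambda>a. {a}"])
  have "h 0 = 0" using assms [of 0 0] by simp
  then show "mfps_coeff (mfps_map h f) a = 0" if "\<And>b. b \<in> {a} \<Longrightarrow> mfps_coeff f b = 0" for f a
    using that by simp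
qed (auto intro!: mfps_eqI simp: assms)

lemma mfps_continuous_compose:
  assumes T: "mfps_continuous T" and U: "mfps_continuous U"
  shows "mfps_continuous (\<lambda>f. T (U f))"
proof -
  obtain S where S: "\<And>a. finite (S a)"
    "\<And>f a. (\<And>b. b \<in> S a \<Longrightarrow> mfps_coeff f b = 0) \<Longrightarrow> mfps_coeff (T f) a = 0"
    using T unfolding mfps_continuous_def by metis
  obtain R where R: "\<And>a. finite (R a)"
    "\<And>f a. (\<And>b. b \<in> R a \<Longrightarrow> mfps_coeff f b = 0) \<Longrightarrow> mfps_coeff (U f) a = 0"
    using U unfolding mfps_continuous_def by metis
  show ?thesis
    by (rule mfps_continuousI [where S = "\<lambda>a. \<Union>b\<in>S a. R b"])
      (auto simp: mfps_continuous_add [OF T] mfps_continuous_add [OF U] S(1) R(1) intro!: S(2) R(2))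
qed

lemma mfps_continuous_finite_sum:
  assumes "\<And>i. i \<in> I \<Longrightarrow> mfps_continuous (T i)" and "finite I"
  shows "mfps_continuous (\<lambda>f. \<Sum>i\<in>I. T i f)"
proof -
  obtain S where S: "\<And>i a. i \<in> I \<Longrightarrow> finite (S i a)"
    "\<And>f i a. i \<in> I \<Longrightarrow> (\<And>b. b \<in> S i a \<Longrightarrow> mfps_coeff f b = 0) \<Longrightarrow> mfps_coeff (T i f) a = 0"
    using assms(1) unfolding mfps_continuous_def by metis
  show ?thesis
    by (rule mfps_continuousI [where S = "\<lambda>a. \<Union>i\<in>I. S i a"])
      (auto simp: mfps_continuous_add [OF assms(1)] sum.distrib S(1) assms(2) intro!: S(2) sum.neutral)
qed

text \<open>Linearity is only over the integers, so that differentiating the polynomial coefficients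
  in x is a derivation as well as differentiating in a series variable.\<close>

definition mfps_derivation :: "(('v, 'a::comm_ring_1) mfps \<Rightarrow> ('v, 'a) mfps) \<Rightarrow> bool"
  where "mfps_derivation D \<longleftrightarrow> mfps_continuous D \<and> (\<forall>f g. D (f * g) = D f * g + f * D g)"

lemma mfps_derivation_continuous: "mfps_derivation D \<Longrightarrow> mfps_continuous D"
  by (simp add: mfps_derivation_def)

lemma mfps_derivation_mult: "mfps_derivation D \<Longrightarrow> D (f * g) = D f * g + f * D g"
  by (simp add: mfps_derivation_def)

lemma mfps_derivation_one:
  assumes "mfps_derivation D"
  shows "D 1 = 0"
  using mfps_derivation_mult [OF assms, of 1 1] by simp

lemma mfps_derivation_power:
  assumes D: "mfps_derivation D"
  shows "D (f ^ Suc m) = of_nat (Suc m) * f ^ m * D f"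
  by (induction m)
    (simp_all add: mfps_derivation_mult [OF D] mfps_derivation_one [OF D] algebra_simps)

text \<open>The exponent of \<open>i\<close> in a product \<open>a + b\<close> is the sum of its
  exponents in \<open>a\<close> and \<open>b\<close>; the two summands yield the two Leibniz
  terms.\<close>

lemma mfps_derivation_diff: "mfps_derivation (mfps_diff i)"
  unfolding mfps_derivation_def
proof (intro conjI allI)
  fix f g :: "('a, 'b) mfps"
  let ?e = "Poly_Mapping.single i (1::nat)"
  \<comment> \<open>The contribution weighted with the exponent in the first factor. The other half
    is the same identity with \<open>f\<close> and \<open>g\<close> exchanged.\<close>
  have half: "(\<Sum>(a, b) | a + b = c + ?e.
        of_nat (Poly_Mapping.lookup a i) * mfps_coeff f a * mfps_coeff g b) =
      mfps_coeff (mfps_diff i f * g) c" for f g :: "('a, 'b) mfps" and c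
  proof -
    \<comment> \<open>Elsewhere the weight is 0. On \<open>?S\<close> the difference
      \<open>a - ?e\<close> is not truncated, so removing \<open>?e\<close> is a bijection onto the
      factorizations of \<open>c\<close>.\<close>
    let ?S = "{(a, b). a + b = c + ?e \<and> Poly_Mapping.lookup a i \<noteq> 0}"
    have shift: "?e + (a - ?e) = a" if "Poly_Mapping.lookup a i \<noteq> 0" for a
      using that
      by (intro poly_mapping_eqI) (auto simp: lookup_add lookup_minus lookup_single when_def)
    have "(\<Sum>(a, b) | a + b = c + ?e. of_nat (Poly_Mapping.lookup a i) * mfps_coeff f a * mfps_coeff g b) =
        (\<Sum>(a, b)\<in>?S. of_nat (Poly_Mapping.lookup a i) * mfps_coeff f a * mfps_coeff g b)"
      by (rule sum.mono_neutral_right [OF finite_split_monomial]) (auto intro!: gr0I)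
    also have "\<dots> = mfps_coeff (mfps_diff i f * g) c"
      unfolding mfps_coeff_mult
    proof (rule sum.reindex_bij_witness [of _ "\<lambda>(a, b). (a + ?e, b)" "\<lambda>(a, b). (a - ?e, b)"]; clarify)
      fix a b assume "a + b = c + ?e" and nz: "0 < Poly_Mapping.lookup a i"
      then have "(a - ?e) + b + ?e = c + ?e"
        using shift [of a] by (metis add.assoc add.commute not_gr_zero)
      then show "(a - ?e) + b = c" by simp
    qed (use shift in \<open>auto simp: lookup_add mfps_coeff_mfps_diff lookup_minus algebra_simps\<close>)
    finally show ?thesis .
  qed
  show "mfps_diff i (f * g) = mfps_diff i f * g + f * mfps_diff i g"
  proof (rule mfps_eqI)
    fix c
    have "mfps_coeff (mfps_diff i (f * g)) c = (\<Sum>(a, b) | a + b = c + ?e.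
        of_nat (Poly_Mapping.lookup (c + ?e) i) * (mfps_coeff f a * mfps_coeff g b))"
      by (simp add: mfps_coeff_mfps_diff mfps_coeff_mult sum_distrib_left lookup_add case_prod_unfold)
    also have "\<dots> = (\<Sum>(a, b) | a + b = c + ?e.
        of_nat (Poly_Mapping.lookup a i) * mfps_coeff f a * mfps_coeff g b +
        of_nat (Poly_Mapping.lookup b i) * mfps_coeff g b * mfps_coeff f a)"
      by (intro sum.cong refl, clarify)
        (metis (no_types, lifting) lookup_add of_nat_add distrib_right mult.assoc mult.commute)
    also have "\<dots> = mfps_coeff (mfps_diff i f * g) c +
        (\<Sum>(a, b) | a + b = c + ?e. of_nat (Poly_Mapping.lookup b i) * mfps_coeff g b * mfps_coeff f a)"
      by (simp add: case_prod_unfold sum.distrib flip: half)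
    also have "(\<Sum>(a, b) | a + b = c + ?e. of_nat (Poly_Mapping.lookup b i) * mfps_coeff g b * mfps_coeff f a) =
        (\<Sum>(a, b) | a + b = c + ?e. of_nat (Poly_Mapping.lookup a i) * mfps_coeff g a * mfps_coeff f b)"
      by (rule sum.reindex_bij_witness [of _ prod.swap prod.swap]) (auto simp: add.commute)
    finally show "mfps_coeff (mfps_diff i (f * g)) c =
        mfps_coeff (mfps_diff i f * g + f * mfps_diff i g) c"
      by (simp only: half mfps_coeff_add mult.commute [of f "mfps_diff i g"])
  qed
qed (rule mfps_continuous_diff)

lemma mfps_derivation_map:
  fixes h :: "'a::comm_ring_1 \<Rightarrow> 'a"
  assumes "\<And>p q. h (p + q) = h p + h q" "\<And>p q. h (p * q) = h p * q + p * h q"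
  shows "mfps_derivation (mfps_map h)"
  unfolding mfps_derivation_def
proof (intro conjI allI mfps_eqI)
  have "h 0 = 0" using assms(1) [of 0 0] by simp
  then have h_sum: "h (sum u S) = (\<Sum>s\<in>S. h (u s))"
    for u :: "('v \<Rightarrow>\<^sub>0 nat) \<times> ('v \<Rightarrow>\<^sub>0 nat) \<Rightarrow> 'a" and S
    by (induction S rule: infinite_finite_induct) (simp_all add: assms(1))
  show "mfps_coeff (mfps_map h (f * g)) a = mfps_coeff (mfps_map h f * g + f * mfps_map h g) a"
    for f g :: "('v, 'a) mfps" and a
    by (simp add: mfps_coeff_mult h_sum assms(2) case_prod_unfold sum.distrib)
qed (rule mfps_continuous_map, rule assms(1))

lemma mfps_diff_const [simp]: "mfps_diff v (mfps_const c) = (0 :: ('b, 'a::comm_ring_1) mfps)"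
proof (rule mfps_eqI)
  fix a :: "'b \<Rightarrow>\<^sub>0 nat"
  have "Poly_Mapping.lookup (a + Poly_Mapping.single v 1) v \<noteq> Poly_Mapping.lookup 0 v"
    by (simp add: lookup_add)
  then have "a + Poly_Mapping.single v 1 \<noteq> 0" by metis
  then show "mfps_coeff (mfps_diff v (mfps_const c)) a = mfps_coeff 0 a"
    by (simp add: mfps_coeff_mfps_diff mfps_coeff_const)
qed

lemma mfps_diff_var:
  "mfps_diff v (mfps_var w) = (if v = w then 1 else (0 :: ('b, 'a::comm_ring_1) mfps))"
proof (rule mfps_eqI)
  fix a :: "'b \<Rightarrow>\<^sub>0 nat"
  show "mfps_coeff (mfps_diff v (mfps_var w)) a = mfps_coeff (if v = w then 1 else (0::('b, 'a) mfps)) a"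
  proof (cases "v = w")
    case True
    then show ?thesis by (simp add: mfps_coeff_mfps_diff mfps_coeff_var mfps_coeff_one)
  next
    case False
    then have "a + Poly_Mapping.single v 1 \<noteq> Poly_Mapping.single w 1"
      by (metis add_eq_0_iff_both_eq_0 lookup_add lookup_single_eq lookup_single_not_eq one_neq_zero)
    with False show ?thesis by (simp add: mfps_coeff_mfps_diff mfps_coeff_var)
  qed
qed

text \<open>Differentiating a series shifts its coefficients and multiplies them by natural numbers,
  which every additive map respects.\<close>

lemma mfps_map_diff:
  fixes h :: "'a::comm_ring_1 \<Rightarrow> 'b::comm_ring_1"
  assumes "\<And>p q. h (p + q) = h p + h q"
  shows "mfps_map h (mfps_diff v f) = mfps_diff v (mfps_map h f)"
proof (rule mfps_eqI)
  fix a
  have h0: "h 0 = 0" using assms [of 0 0] by simp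
  have "h (of_nat n * p) = of_nat n * h p" for n p
    by (induction n) (simp_all add: h0 assms distrib_right)
  then show "mfps_coeff (mfps_map h (mfps_diff v f)) a = mfps_coeff (mfps_diff v (mfps_map h f)) a"
    by (simp only: mfps_coeff_map mfps_coeff_mfps_diff)
qed


section \<open>Weights\<close>

text \<open>A filtration by a weight of monomials. Total degree serves for the convergence of
  \<open>mfps_exp\<close>; the degree in \<mu> serves for series in \<mu>, for values at \<mu> = 0
  and for the uniqueness of solutions.\<close>

definition vanishes_below :: "(('v \<Rightarrow>\<^sub>0 nat) \<Rightarrow> nat) \<Rightarrow> nat \<Rightarrow> ('v, 'a::zero) mfps \<Rightarrow> bool"
  where "vanishes_below w n f \<longleftrightarrow> (\<forall>a. w a < n \<longrightarrow> mfps_coeff f a = 0)"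

lemma vanishes_below_zero [simp]: "vanishes_below w 0 f"
  by (simp add: vanishes_below_def)

lemma vanishes_below_sum:
  "(\<And>s. s \<in> S \<Longrightarrow> vanishes_below w n (f s)) \<Longrightarrow> vanishes_below w n (sum f S)"
  by (simp add: vanishes_below_def)

lemma vanishes_below_mult:
  fixes f :: "('v, 'a::comm_ring_1) mfps"
  assumes w: "\<And>a b. w (a + b) = w a + w b"
    and f: "vanishes_below w m f" and g: "vanishes_below w n g"
  shows "vanishes_below w (m + n) (f * g)"
  unfolding vanishes_below_def
proof (intro allI impI)
  fix c :: "'v \<Rightarrow>\<^sub>0 nat" assume c: "w c < m + n"
  show "mfps_coeff (f * g) c = 0"
    unfolding mfps_coeff_mult
  proof (rule sum.neutral, clarify)
    fix a b assume "c = a + b"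
    then have "w a < m \<or> w b < n" using c by (auto simp: w)
    then show "mfps_coeff f a * mfps_coeff g b = 0"
      using f g by (auto simp: vanishes_below_def)
  qed
qed

lemma vanishes_below_power:
  fixes f :: "('v, 'a::comm_ring_1) mfps"
  assumes w: "\<And>a b. w (a + b) = w a + w b" and f: "vanishes_below w 1 f"
  shows "vanishes_below w n (f ^ n)"
proof (induction n)
  case (Suc n)
  then show ?case using vanishes_below_mult [OF w f Suc] by simp
qed simp

lemma vanishes_below_suminf:
  assumes "\<And>m. vanishes_below w n (g m)"
  shows "vanishes_below w n (mfps_suminf g)"
  using assms by (simp add: vanishes_below_def mfps_coeff_suminf)

text \<open>At the coefficient of \<open>a\<close> only indices up to \<open>w a\<close>
  survive.\<close>

lemma locally_finite_if_vanishes_below: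
  fixes g :: "nat \<Rightarrow> ('a, 'b::comm_ring_1) mfps"
  assumes "\<And>m. vanishes_below w m (g m)"
  shows "locally_finite g"
  unfolding locally_finite_def
proof
  fix a :: "'a \<Rightarrow>\<^sub>0 nat"
  have "{m. mfps_coeff (g m) a \<noteq> 0} \<subseteq> {..w a}"
    using assms by (auto simp: vanishes_below_def not_less [symmetric])
  then show "finite {m. mfps_coeff (g m) a \<noteq> 0}"
    by (rule finite_subset) simp
qed

section \<open>The two weights: total degree and degree in \<mu>\<close>

definition mdegree :: "('v \<Rightarrow>\<^sub>0 nat) \<Rightarrow> nat"
  where "mdegree a = (\<Sum>v\<in>Poly_Mapping.keys a. Poly_Mapping.lookup a v)"

lemma mdegree_add: "mdegree (a + b) = mdegree a + mdegree b"
  unfolding mdegree_def by (rule setsum_keys_plus_distrib) auto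

lemma mdegree_eq_0_iff: "mdegree a = 0 \<longleftrightarrow> a = 0"
  by (auto simp: mdegree_def in_keys_iff intro!: poly_mapping_eqI)

lemma mdegree_single [simp]: "mdegree (Poly_Mapping.single v n) = n"
  by (simp add: mdegree_def)

lemma vanishes_below_mdegree_1: "vanishes_below mdegree 1 f \<longleftrightarrow> mfps_coeff f 0 = 0"
  by (auto simp: vanishes_below_def mdegree_eq_0_iff)

abbreviation mu_degree :: "('n pvar \<Rightarrow>\<^sub>0 nat) \<Rightarrow> nat"
  where "mu_degree a \<equiv> Poly_Mapping.lookup a Mu"

lemma vanishes_below_mu: "vanishes_below mu_degree 1 mu"
  by (auto simp: vanishes_below_def mfps_coeff_var)

lemma vanishes_below_mu_power:
  "vanishes_below mu_degree n (mu ^ n :: ('n pvar, 'a::comm_ring_1) mfps)"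
  by (rule vanishes_below_power [OF lookup_add vanishes_below_mu])


section \<open>Polynomials\<close>

lemma mpoly_const_zero [simp]: "mpoly_const 0 = 0"
  by (simp add: mpoly_const_def)

lemma mpoly_const_one [simp]: "mpoly_const 1 = 1"
  by (simp add: mpoly_const_def)

lemma mpoly_const_add: "mpoly_const (c + d) = mpoly_const c + mpoly_const (d::'a::comm_ring_1)"
  by (simp add: mpoly_const_def single_add)

lemma mpoly_const_mult: "mpoly_const (c * d) = mpoly_const c * mpoly_const (d::'a::comm_ring_1)"
  by (simp add: mpoly_const_def mult_single)

lemma mpoly_const_sum: "mpoly_const (sum f S) = (\<Sum>s\<in>S. mpoly_const (f s :: 'a::comm_ring_1))"
  by (induction S rule: infinite_finite_induct) (simp_all add: mpoly_const_add)

lemma mpoly_const_of_nat: "mpoly_const (of_nat n) = (of_nat n :: (_, 'a::comm_ring_1) mpoly)"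
  by (simp add: mpoly_const_def)

lemma lookup_mpoly_const_mult [simp]:
  "Poly_Mapping.lookup (mpoly_const c * p) b = c * Poly_Mapping.lookup p (b :: 'v \<Rightarrow>\<^sub>0 nat)"
  for c :: "'a::comm_ring_1"
  unfolding mpoly_const_def mult_map_scale_conv_mult [symmetric]
  by (simp add: Poly_Mapping.map.rep_eq when_def)

lemma poly_mapping_eq_sum_single:
  "(\<Sum>k\<in>Poly_Mapping.keys p. Poly_Mapping.single k (Poly_Mapping.lookup p k)) = p"
  by (rule poly_mapping_eqI)
    (simp add: lookup_sum lookup_single when_def in_keys_iff)

lemma poly_mapping_additive_induct [case_names single add]:
  fixes p :: "'a \<Rightarrow>\<^sub>0 'b::comm_monoid_add"
  assumes "\<And>a c. P (Poly_Mapping.single a c)" "\<And>p q. P p \<Longrightarrow> P q \<Longrightarrow> P (p + q)"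
  shows "P p"
proof -
  have P0: "P 0" using assms(1) [of undefined 0] by simp
  have "P (\<Sum>k\<in>S. Poly_Mapping.single k (Poly_Mapping.lookup p k))" if "finite S" for S
    using that by (induction S rule: finite_induct) (auto intro: P0 assms)
  from this [OF finite_keys [of p]] show ?thesis by (simp only: poly_mapping_eq_sum_single)
qed

lemma mpoly_diff_add: "mpoly_diff i (p + q) = mpoly_diff i p + mpoly_diff i q"
  by (rule poly_mapping_eqI) (simp add: lookup_mpoly_diff lookup_add distrib_left)

lemma mpoly_diff_zero [simp]: "mpoly_diff i 0 = 0"
  by (rule poly_mapping_eqI) (simp add: lookup_mpoly_diff)

lemma mpoly_diff_single:
  "mpoly_diff i (Poly_Mapping.single a c) =
    Poly_Mapping.single (a - Poly_Mapping.single i 1) (of_nat (Poly_Mapping.lookup a i) * c)"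
  by (cases "c = 0") (simp_all add: mpoly_diff_def)

lemma mpoly_diff_const [simp]: "mpoly_diff i (mpoly_const c) = 0"
  by (simp add: mpoly_const_def mpoly_diff_single)

lemma mpoly_diff_one [simp]: "mpoly_diff i 1 = 0"
  using mpoly_diff_const [of i 1] by (simp del: mpoly_diff_const)

lemma mpoly_diff_var:
  "mpoly_diff i (mpoly_var j) = (if i = j then 1 else (0 :: (_, 'a::comm_ring_1) mpoly))"
  by (auto simp: mpoly_var_def mpoly_diff_single lookup_single when_def)

lemma mpoly_diff_mult:
  "mpoly_diff i (p * q) = mpoly_diff i p * q + p * mpoly_diff i (q :: ('v, 'a::comm_ring_1) mpoly)"
proof (induction p rule: poly_mapping_additive_induct)
  case (single a c)
  show ?case
  proof (induction q rule: poly_mapping_additive_induct)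
    case (single b d)
    let ?e = "Poly_Mapping.single i (1::nat)"
    \<comment> \<open>Truncated subtraction is harmless: if the exponent at \<open>i\<close> is 0,
      both coefficients vanish, and otherwise nothing is truncated.\<close>
    have *: "Poly_Mapping.single (x - ?e + y) (of_nat (Poly_Mapping.lookup x i) * z) =
        Poly_Mapping.single (x + y - ?e) (of_nat (Poly_Mapping.lookup x i) * z)" for x y and z :: 'a
    proof (cases "Poly_Mapping.lookup x i = 0")
      case False
      then have "x - ?e + y = x + y - ?e"
        by (intro poly_mapping_eqI) (auto simp: lookup_add lookup_minus lookup_single when_def)
      then show ?thesis by simp
    qed simp
    show ?case
      using * [of a b "c * d"] * [of b a "c * d"]
      by (simp add: mpoly_diff_single mult_single lookup_add algebra_simps flip: single_add)
  qed (simp add: distrib_left mpoly_diff_add)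
qed (simp add: distrib_right mpoly_diff_add)

section \<open>Iterated derivatives and the action of \<open>F_i(\<partial>)\<close> on
  polynomials\<close>

lemma lookup_mpoly_diff_power:
  "\<exists>N::_ \<Rightarrow> nat. \<forall>p b. Poly_Mapping.lookup ((mpoly_diff i ^^ k) (p :: ('v, 'a::comm_ring_1) mpoly)) b =
    of_nat (N b) * Poly_Mapping.lookup p (b + Poly_Mapping.single i k)"
proof (induction k)
  case 0
  show ?case by (rule exI [of _ "\<lambda>_. 1"]) simp
next
  case (Suc k)
  then obtain N :: "_ \<Rightarrow> nat" where
    N: "\<And>p b. Poly_Mapping.lookup ((mpoly_diff i ^^ k) (p :: ('v, 'a) mpoly)) b =
      of_nat (N b) * Poly_Mapping.lookup p (b + Poly_Mapping.single i k)"
    by blast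
  have "b + Poly_Mapping.single i 1 + Poly_Mapping.single i k = b + Poly_Mapping.single i (Suc k)" for b
    by (simp add: add.assoc flip: single_add)
  then show ?case
    by (intro exI [of _ "\<lambda>b. (Poly_Mapping.lookup b i + 1) * N (b + Poly_Mapping.single i 1)"])
      (simp add: lookup_mpoly_diff N mult.assoc distrib_right)
qed

lemma fold_mpoly_diff_insert:
  assumes "finite S" "i \<notin> S"
  shows "Finite_Set.fold (\<lambda>i. mpoly_diff i ^^ f i) p (insert i S) =
    (mpoly_diff i ^^ f i) (Finite_Set.fold (\<lambda>i. mpoly_diff i ^^ f i) p S)"
proof -
  interpret comp_fun_commute "\<lambda>i. mpoly_diff i ^^ f i"
    by (rule comp_fun_commute_mpoly_diff)
  show ?thesis using assms by simp
qed

text \<open>The point is that the factor is independent of \<open>p\<close>: linearity in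
  \<open>p\<close> follows coefficientwise, and a nonzero derivative requires a multiple of
  \<open>a\<close> among the monomials of \<open>p\<close>.\<close>

lemma lookup_mpoly_diffs:
  "\<exists>N::_ \<Rightarrow> nat. \<forall>p b. Poly_Mapping.lookup (mpoly_diffs a (p :: ('v, 'a::comm_ring_1) mpoly)) b =
    of_nat (N b) * Poly_Mapping.lookup p (b + a)"
proof -
  let ?f = "\<lambda>i. mpoly_diff i ^^ Poly_Mapping.lookup a i"
  let ?m = "\<lambda>S. \<Sum>i\<in>S. Poly_Mapping.single i (Poly_Mapping.lookup a i)"
  have "\<exists>N::_ \<Rightarrow> nat. \<forall>p b. Poly_Mapping.lookup (Finite_Set.fold ?f (p :: ('v, 'a) mpoly) S) b =
      of_nat (N b) * Poly_Mapping.lookup p (b + ?m S)" if "finite S" for S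
    using that
  proof (induction S)
    case empty
    show ?case by (rule exI [of _ "\<lambda>_. 1"]) simp
  next
    case (insert i S)
    obtain N :: "_ \<Rightarrow> nat" where
      N: "\<And>p b. Poly_Mapping.lookup (Finite_Set.fold ?f (p :: ('v, 'a) mpoly) S) b =
        of_nat (N b) * Poly_Mapping.lookup p (b + ?m S)"
      using insert.IH by blast
    obtain M :: "_ \<Rightarrow> nat" where
      M: "\<And>p b. Poly_Mapping.lookup (?f i (p :: ('v, 'a) mpoly)) b =
        of_nat (M b) * Poly_Mapping.lookup p (b + Poly_Mapping.single i (Poly_Mapping.lookup a i))"
      using lookup_mpoly_diff_power [where i = i and k = "Poly_Mapping.lookup a i"] by blast
    show ?case
      by (rule exI [of _ "\<lambda>b. M b * N (b + Poly_Mapping.single i (Poly_Mapping.lookup a i))"])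
        (simp add: fold_mpoly_diff_insert insert.hyps M N
          mult.assoc add.assoc)
  qed
  from this [OF finite_keys [of a]] show ?thesis
    unfolding mpoly_diffs_def by (simp only: poly_mapping_eq_sum_single)
qed

lemma mpoly_diffs_add:
  "mpoly_diffs a (p + q) = mpoly_diffs a p + mpoly_diffs a (q :: (_, 'a::comm_ring_1) mpoly)"
  using lookup_mpoly_diffs [of a]
  by (metis (no_types, lifting) lookup_add distrib_left poly_mapping_eqI)

lemma mpoly_diffs_const_mult:
  "mpoly_diffs a (mpoly_const c * p) = mpoly_const c * mpoly_diffs a (p :: (_, 'a::comm_ring_1) mpoly)"
proof -
  obtain N :: "_ \<Rightarrow> nat" where
    N: "\<And>p b. Poly_Mapping.lookup (mpoly_diffs a (p :: (_, 'a) mpoly)) b =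
      of_nat (N b) * Poly_Mapping.lookup p (b + a)"
    using lookup_mpoly_diffs by blast
  show ?thesis by (rule poly_mapping_eqI) (simp add: N mult.left_commute)
qed

text \<open>Such an \<open>a\<close> divides one of the finitely many monomials of \<open>p\<close>.
  This makes the \<open>Sum_any\<close> in \<open>diff_op\<close> a genuine sum.\<close>

lemma finite_mpoly_diffs_nonzero:
  "finite {a. mpoly_diffs a (p :: ('v, 'a::comm_ring_1) mpoly) \<noteq> 0}"
proof (rule finite_subset)
  show "{a. mpoly_diffs a p \<noteq> 0} \<subseteq> (\<Union>c\<in>Poly_Mapping.keys p. {a. \<exists>b. a + b = c})"
  proof clarify
    fix a assume "mpoly_diffs a p \<noteq> 0"
    then obtain b where "Poly_Mapping.lookup (mpoly_diffs a p) b \<noteq> 0"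
      by (metis lookup_zero poly_mapping_eqI)
    then have "Poly_Mapping.lookup p (b + a) \<noteq> 0"
      using lookup_mpoly_diffs [of a] by (metis mult_zero_right)
    then show "a \<in> (\<Union>c\<in>Poly_Mapping.keys p. {a. \<exists>b. a + b = c})"
      by (auto simp: in_keys_iff add.commute intro!: bexI [of _ "b + a"])
  qed
qed (simp add: finite_below_monomial)

lemma finite_diff_op_terms:
  "finite {a. mpoly_const (mfps_coeff G a) * mpoly_diffs a (p :: ('v, 'a::comm_ring_1) mpoly) \<noteq> 0}"
  by (rule finite_subset [OF _ finite_mpoly_diffs_nonzero [of p]]) auto

lemma diff_op_add: "diff_op G (p + q) = diff_op G p + diff_op G q"
  unfolding diff_op_def
  by (simp add: mpoly_diffs_add distrib_left Sum_any.distrib finite_diff_op_terms)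

lemma diff_op_const_mult: "diff_op G (mpoly_const c * p) = mpoly_const c * diff_op G p"
  unfolding diff_op_def
  by (simp add: mpoly_diffs_const_mult Sum_any_right_distrib finite_diff_op_terms mult.left_commute)

lemma xF_op_add: "xF_op F (p + q) = xF_op F p + xF_op F q"
  by (simp add: xF_op_def diff_op_add distrib_left sum.distrib)

lemma xF_op_const_mult: "xF_op F (mpoly_const c * p) = mpoly_const c * xF_op F p"
  by (simp add: xF_op_def diff_op_const_mult sum_distrib_left mult.left_commute)


section \<open>Inclusions of rings of series\<close>

text \<open>A right inverse of \<open>map_key Q\<close>. As a sum over the keys it runs parallel to
  the fold in \<open>mpoly_diffs\<close>.\<close>

definition q_monomial :: "('n \<Rightarrow>\<^sub>0 nat) \<Rightarrow> ('n pvar \<Rightarrow>\<^sub>0 nat)"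
  where "q_monomial a = (\<Sum>i\<in>Poly_Mapping.keys a. Poly_Mapping.single (Q i) (Poly_Mapping.lookup a i))"

lemma lookup_q_monomial_Mu [simp]: "Poly_Mapping.lookup (q_monomial a) Mu = 0"
  by (simp add: q_monomial_def lookup_sum lookup_single)

lemma lookup_q_monomial_Q [simp]: "Poly_Mapping.lookup (q_monomial a) (Q i) = Poly_Mapping.lookup a i"
  by (simp add: q_monomial_def lookup_sum lookup_single when_def in_keys_iff)

lemma inj_Q: "inj Q"
  by (rule injI) simp

lemma lookup_map_key_Q [simp]:
  "Poly_Mapping.lookup (Poly_Mapping.map_key Q a) i = Poly_Mapping.lookup a (Q i)"
  by (simp add: map_key.rep_eq [OF inj_Q])

lemma map_key_q_monomial [simp]: "Poly_Mapping.map_key Q (q_monomial a) = a"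
  by (rule poly_mapping_eqI) simp

lemma q_monomial_map_key:
  assumes "mu_degree a = 0"
  shows "q_monomial (Poly_Mapping.map_key Q a) = a"
proof (rule poly_mapping_eqI)
  fix v
  show "Poly_Mapping.lookup (q_monomial (Poly_Mapping.map_key Q a)) v = Poly_Mapping.lookup a v"
    using assms by (cases v) simp_all
qed

lemma q_monomial_add: "q_monomial (a + b) = q_monomial a + q_monomial b"
proof (rule poly_mapping_eqI)
  fix v
  show "Poly_Mapping.lookup (q_monomial (a + b)) v = Poly_Mapping.lookup (q_monomial a + q_monomial b) v"
    by (cases v) (simp_all add: lookup_add)
qed

lemma map_key_Q_add: "Poly_Mapping.map_key Q (a + b) = Poly_Mapping.map_key Q a + Poly_Mapping.map_key Q b"
  by (rule poly_mapping_eqI) (simp add: lookup_add)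

lemma mfps_coeff_lift_q:
  "mfps_coeff (lift_q f) a = (if mu_degree a = 0 then mfps_coeff f (Poly_Mapping.map_key Q a) else 0)"
  by (simp add: lift_q_def)

lemma lift_q_sum: "lift_q (sum f S) = (\<Sum>s\<in>S. lift_q (f s :: (_, 'a::comm_ring_1) mfps))"
  by (rule mfps_eqI) (simp add: mfps_coeff_lift_q)

text \<open>A monomial free of \<mu> factors only into such monomials, which correspond to monomials
  in q; in a factorization of any other monomial, \<mu> occurs in one of the factors.\<close>

lemma lift_q_mult: "lift_q (f * g) = lift_q f * lift_q (g :: ('n, 'a::comm_ring_1) mfps)"
proof (rule mfps_eqI)
  fix c :: "'n pvar \<Rightarrow>\<^sub>0 nat"
  show "mfps_coeff (lift_q (f * g)) c = mfps_coeff (lift_q f * lift_q g) c"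
  proof (cases "mu_degree c = 0")
    case True
    have "(\<Sum>(a, b) | a + b = Poly_Mapping.map_key Q c. mfps_coeff f a * mfps_coeff g b) =
        (\<Sum>(a, b) | a + b = c. mfps_coeff (lift_q f) a * mfps_coeff (lift_q g) b)"
      by (rule sum.reindex_bij_witness [of _ "\<lambda>(a, b). (Poly_Mapping.map_key Q a, Poly_Mapping.map_key Q b)"
            "\<lambda>(a, b). (q_monomial a, q_monomial b)"])
        (use True in \<open>auto simp: q_monomial_map_key lookup_add mfps_coeff_lift_q map_key_Q_add
          simp flip: q_monomial_add\<close>)
    then show ?thesis using True by (simp add: mfps_coeff_mult mfps_coeff_lift_q [of "f * g"])
  next
    case False
    then have "mfps_coeff (lift_q f * lift_q g) c = 0"
      unfolding mfps_coeff_mult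
      by (intro sum.neutral) (auto simp: mfps_coeff_lift_q lookup_add)
    with False show ?thesis by (simp add: mfps_coeff_lift_q)
  qed
qed

lemma mfps_diff_Q_lift_q: "mfps_diff (Q i) (lift_q f) = lift_q (mfps_diff i (f :: (_, 'a::comm_ring_1) mfps))"
  by (rule mfps_eqI)
    (simp add: mfps_coeff_mfps_diff mfps_coeff_lift_q lookup_add lookup_single map_key_Q_add
      map_key_single [OF inj_Q])

lemma mfps_diff_Mu_lift_q: "mfps_diff Mu (lift_q f) = (0 :: (_, 'a::comm_ring_1) mfps)"
  by (rule mfps_eqI) (simp add: mfps_coeff_mfps_diff mfps_coeff_lift_q lookup_add)

lemma mfps_coeff_lift_x [simp]: "mfps_coeff (lift_x f) a = mpoly_const (mfps_coeff f a)"
  by (simp add: lift_x_def)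

lemma mfps_continuous_lift_x: "mfps_continuous (lift_x :: ('n pvar, 'a::comm_ring_1) mfps \<Rightarrow> _)"
  unfolding lift_x_def by (rule mfps_continuous_map) (rule mpoly_const_add)

lemma lift_x_mult: "lift_x (f * g) = lift_x f * lift_x (g :: (_, 'a::comm_ring_1) mfps)"
  by (rule mfps_eqI) (simp add: mfps_coeff_mult mpoly_const_sum mpoly_const_mult case_prod_unfold)

lemma lift_x_diff: "lift_x (mfps_diff v f) = mfps_diff v (lift_x (f :: (_, 'a::comm_ring_1) mfps))"
  unfolding lift_x_def by (rule mfps_map_diff) (rule mpoly_const_add)

lemma lift_x_var: "lift_x (mfps_var v) = (mfps_var v :: (_, (_, 'a::comm_ring_1) mpoly) mfps)"
  by (rule mfps_eqI) (simp add: mfps_coeff_var)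

text \<open>The coefficients of \<open>lift_x f\<close> are constants in x, so \<open>h\<close>
  passes them in every term of the convolution. This is the core of the commutation of operators in
  x with operators in q.\<close>

lemma mfps_map_lift_x_mult:
  assumes add: "\<And>p q. h (p + q) = h p + h q"
    and const: "\<And>c p. h (mpoly_const c * p) = mpoly_const c * h p"
  shows "mfps_map h (lift_x f * g) = lift_x f * mfps_map h (g :: (_, ('n, 'a::comm_ring_1) mpoly) mfps)"
proof (rule mfps_eqI)
  fix c
  have "h 0 = 0" using add [of 0 0] by simp
  then have "h (sum u S) = (\<Sum>s\<in>S. h (u s))"
    for u :: "('n pvar \<Rightarrow>\<^sub>0 nat) \<times> ('n pvar \<Rightarrow>\<^sub>0 nat) \<Rightarrow> ('n, 'a) mpoly" and S
    by (induction S rule: infinite_finite_induct) (simp_all add: add)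
  then show "mfps_coeff (mfps_map h (lift_x f * g)) c = mfps_coeff (lift_x f * mfps_map h g) c"
    by (simp add: mfps_coeff_mult const case_prod_unfold)
qed

lemma scalar_one [simp]: "scalar 1 = 1"
  by (simp add: scalar_def)

lemma scalar_mult: "scalar (c * d) = scalar c * scalar (d :: 'a::comm_ring_1)"
  by (simp add: scalar_def mpoly_const_mult mfps_const_mult)

lemma scalar_of_nat: "scalar (of_nat n) = (of_nat n :: (_, (_, 'a::comm_ring_1) mpoly) mfps)"
  by (simp add: scalar_def mpoly_const_of_nat mfps_const_of_nat)

lemma scalar_inverse_fact_Suc:
  "scalar (1 / fact (Suc m)) * of_nat (Suc m) =
    (scalar (1 / fact m) :: ('n pvar, ('n, 'a::field_char_0) mpoly) mfps)"
  unfolding scalar_of_nat [symmetric] scalar_mult [symmetric]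
  by (simp add: field_simps del: of_nat_Suc)

lemma mfps_const_inverse_fact_Suc:
  "mfps_const (1 / fact (Suc m)) * of_nat (Suc m) = (mfps_const (1 / fact m) :: ('v, 'a::field_char_0) mfps)"
  unfolding mfps_const_of_nat [symmetric] mfps_const_mult [symmetric]
  by (simp add: field_simps del: of_nat_Suc)


section \<open>Exponentials\<close>

text \<open>Without a constant term, the \<open>m\<close>-th power starts in total degree
  \<open>m\<close> or later.\<close>

lemma locally_finite_exp:
  assumes "mfps_coeff f 0 = 0"
  shows "locally_finite (\<lambda>m. scalar (c m) * f ^ m)"
proof (rule locally_finite_if_vanishes_below)
  show "vanishes_below mdegree m (scalar (c m) * f ^ m)" for m
    using vanishes_below_mult [OF mdegree_add vanishes_below_zero
        vanishes_below_power [OF mdegree_add, of f m]] assms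
    by (simp add: vanishes_below_mdegree_1 del: One_nat_def)
qed

lemma mfps_derivation_scalar_mult:
  assumes "mfps_derivation D" "D (scalar c) = 0"
  shows "D (scalar c * f) = scalar c * D f"
  using assms by (simp add: mfps_derivation_mult)

text \<open>The factor \<open>Suc m\<close> from the power rule cancels in the factorial, so
  \<open>D\<close> turns term \<open>Suc m\<close> into \<open>D f\<close> times term
  \<open>m\<close>, and it kills term 0. The lemma serves for derivatives in q, \<mu> and x and for
  the vector field.\<close>

lemma mfps_derivation_exp:
  assumes D: "mfps_derivation D" and scalar: "\<And>c. D (scalar c) = 0" and f: "mfps_coeff f 0 = 0"
  shows "D (mfps_exp f) = D f * mfps_exp f"
proof -
  let ?g = "\<lambda>m. scalar (1 / fact m) * f ^ m"
  note cont = mfps_derivation_continuous [OF D]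
  have g: "locally_finite ?g" using f by (rule locally_finite_exp)
  have Suc: "D (?g (Suc m)) = D f * ?g m" for m
  proof -
    have "D (?g (Suc m)) = (scalar (1 / fact (Suc m)) * of_nat (Suc m)) * f ^ m * D f"
      by (simp only: mfps_derivation_scalar_mult [OF D scalar] mfps_derivation_power [OF D] mult.assoc)
    then show ?thesis
      unfolding scalar_inverse_fact_Suc by (simp add: mult_ac)
  qed
  have "D (mfps_exp f) = mfps_suminf (\<lambda>m. D (?g m))"
    unfolding mfps_exp_def by (rule mfps_continuous_suminf [OF cont g])
  also have "\<dots> = D (?g 0) + mfps_suminf (\<lambda>m. D (?g (Suc m)))"
    by (rule mfps_suminf_Suc) (rule mfps_continuous_suminf [OF cont g])
  also have "\<dots> = mfps_suminf (\<lambda>m. D f * ?g m)"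
    unfolding Suc by (simp add: mfps_derivation_one [OF D])
  also have "\<dots> = D f * mfps_exp f"
    unfolding mfps_exp_def by (rule mfps_continuous_suminf(2) [OF mfps_continuous_mult g, symmetric])
  finally show ?thesis .
qed

lemma mfps_diff_scalar [simp]: "mfps_diff v (scalar c) = (0 :: (_, (_, 'a::comm_ring_1) mpoly) mfps)"
  by (simp add: scalar_def)

lemma mfps_diff_x_var [simp]: "mfps_diff v (x_var j) = (0 :: (_, (_, 'a::comm_ring_1) mpoly) mfps)"
  by (simp add: x_var_def)

lemma mfps_map_map: "mfps_map h (mfps_map k f) = mfps_map (\<lambda>x. h (k x)) f"
  by (rule mfps_eqI) simp

section \<open>The series \<open>E\<close> and the action of derivatives on it\<close>

definition plane_wave :: "('n::finite pvar, ('n, 'a::field_char_0) mpoly) mfps"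
  where "plane_wave = mfps_exp (\<Sum>j\<in>UNIV. q_var j * x_var j)"

lemma mfps_coeff_0_mult:
  "mfps_coeff (f * g) 0 = mfps_coeff f 0 * mfps_coeff g (0 :: 'v \<Rightarrow>\<^sub>0 nat)"
proof -
  have "{(a, b). a + b = (0 :: 'v \<Rightarrow>\<^sub>0 nat)} = {(0, 0)}"
  proof (safe)
    fix a b :: "'v \<Rightarrow>\<^sub>0 nat" assume "a + b = 0"
    then have "mdegree a + mdegree b = 0" by (metis mdegree_add mdegree_eq_0_iff)
    then show "a = 0" "b = 0" by (simp_all add: mdegree_eq_0_iff)
  qed simp
  then show ?thesis by (simp add: mfps_coeff_mult)
qed

lemma mfps_coeff_0_var [simp]: "mfps_coeff (mfps_var v) 0 = 0"
proof -
  have "Poly_Mapping.lookup (Poly_Mapping.single v (1::nat)) v \<noteq> Poly_Mapping.lookup 0 v" by simp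
  then have "0 \<noteq> Poly_Mapping.single v (1::nat)" by metis
  then show ?thesis by (simp add: mfps_coeff_var del: One_nat_def)
qed

lemma mfps_coeff_0_qx: "mfps_coeff (\<Sum>j\<in>UNIV. q_var j * x_var j) 0 = 0"
  by (simp add: mfps_coeff_0_mult)

lemma mfps_diff_Q_plane_wave: "mfps_diff (Q i) plane_wave = x_var i * plane_wave"
proof -
  have "mfps_diff (Q i) plane_wave = mfps_diff (Q i) (\<Sum>j\<in>UNIV. q_var j * x_var j) * plane_wave"
    unfolding plane_wave_def
    by (rule mfps_derivation_exp [OF mfps_derivation_diff _ mfps_coeff_0_qx]) simp
  also have "mfps_diff (Q i) (\<Sum>j\<in>UNIV. q_var j * x_var j) = x_var i"
    by (simp add: mfps_continuous_sum [OF mfps_continuous_diff]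
        mfps_derivation_mult [OF mfps_derivation_diff] mfps_diff_var if_distrib [of "\<lambda>x. x * _"] cong: if_cong)
  finally show ?thesis .
qed

lemma mfps_diff_Mu_plane_wave: "mfps_diff Mu plane_wave = 0"
proof -
  have "mfps_diff Mu plane_wave = mfps_diff Mu (\<Sum>j\<in>UNIV. q_var j * x_var j) * plane_wave"
    unfolding plane_wave_def
    by (rule mfps_derivation_exp [OF mfps_derivation_diff _ mfps_coeff_0_qx]) simp
  then show ?thesis
    by (simp add: mfps_continuous_sum [OF mfps_continuous_diff]
        mfps_derivation_mult [OF mfps_derivation_diff] mfps_diff_var)
qed

lemma mfps_derivation_map_mpoly_diff:
  "mfps_derivation (mfps_map (mpoly_diff i :: ('n, 'a::comm_ring_1) mpoly \<Rightarrow> _))"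
  by (rule mfps_derivation_map [OF mpoly_diff_add mpoly_diff_mult])

lemma mfps_map_mpoly_diff_monom [simp]:
  "mfps_map (mpoly_diff i) (mfps_monom a) = (0 :: (_, (_, 'a::comm_ring_1) mpoly) mfps)"
  by (rule mfps_eqI) (simp add: mfps_coeff_monom)

lemma mfps_map_mpoly_diff_x_var:
  "mfps_map (mpoly_diff i) (x_var j) = (if i = j then 1 else (0 :: (_, (_, 'a::comm_ring_1) mpoly) mfps))"
  by (auto intro!: mfps_eqI simp: x_var_def mfps_coeff_const mpoly_diff_var mfps_coeff_one)

lemma mfps_map_mpoly_diff_plane_wave:
  "mfps_map (mpoly_diff i) plane_wave = mfps_var (Q i) * plane_wave"
proof -
  have "mfps_map (mpoly_diff i) plane_wave =
      mfps_map (mpoly_diff i) (\<Sum>j\<in>UNIV. q_var j * x_var j) * plane_wave"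
    unfolding plane_wave_def
    by (rule mfps_derivation_exp [OF mfps_derivation_map_mpoly_diff _ mfps_coeff_0_qx])
      (auto intro!: mfps_eqI simp: scalar_def mfps_coeff_const)
  also have "mfps_map (mpoly_diff i) (\<Sum>j\<in>UNIV. q_var j * x_var j) = mfps_var (Q i)"
    by (simp add: mfps_continuous_sum [OF mfps_derivation_continuous, OF mfps_derivation_map_mpoly_diff]
        mfps_derivation_mult [OF mfps_derivation_map_mpoly_diff] mfps_var_eq_monom
        mfps_map_mpoly_diff_x_var
        if_distrib [of "\<lambda>x. _ * x"] cong: if_cong)
  finally show ?thesis .
qed

text \<open>The monomial \<open>c\<close> in front lets the lemma be chained over several variables,
  since the result has the same form again.\<close>

lemma mfps_map_mpoly_diff_power_plane_wave:
  "mfps_map (mpoly_diff i ^^ k)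
      (mfps_monom c * (plane_wave :: ('n::finite pvar, ('n, 'a::field_char_0) mpoly) mfps)) =
    mfps_monom (Poly_Mapping.single (Q i) k + c) * plane_wave"
proof (induction k)
  case (Suc k)
  have "mfps_map (mpoly_diff i ^^ Suc k)
        (mfps_monom c * (plane_wave :: ('n pvar, ('n, 'a) mpoly) mfps)) =
      mfps_map (mpoly_diff i) (mfps_map (mpoly_diff i ^^ k) (mfps_monom c * plane_wave))"
    by (simp add: mfps_map_map o_def)
  also have "\<dots> = mfps_var (Q i) * mfps_monom (Poly_Mapping.single (Q i) k + c) * plane_wave"
    unfolding Suc
    by (simp add: mfps_derivation_mult [OF mfps_derivation_map_mpoly_diff]
        mfps_map_mpoly_diff_plane_wave mult_ac)
  also have "mfps_var (Q i) * mfps_monom (Poly_Mapping.single (Q i) k + c) =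
      mfps_monom (Poly_Mapping.single (Q i) (Suc k) + c)"
    by (simp add: mfps_var_eq_monom mfps_monom_mult flip: single_add add.assoc)
  finally show ?case .
qed (simp add: mfps_map_def mfps_coeff_inverse id_def)

lemma mfps_map_mpoly_diffs_plane_wave:
  "mfps_map (mpoly_diffs a) (plane_wave :: ('n::finite pvar, ('n, 'a::field_char_0) mpoly) mfps) =
    mfps_monom (q_monomial a) * plane_wave"
proof -
  let ?f = "\<lambda>i. mpoly_diff i ^^ Poly_Mapping.lookup a i"
  let ?E = "plane_wave :: ('n pvar, ('n, 'a) mpoly) mfps"
  have "mfps_map (\<lambda>p. Finite_Set.fold ?f p S) ?E =
      mfps_monom (\<Sum>i\<in>S. Poly_Mapping.single (Q i) (Poly_Mapping.lookup a i)) * plane_wave"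
    if "finite S" for S
    using that
  proof (induction S)
    case empty
    show ?case by (simp add: mfps_map_def mfps_coeff_inverse flip: mfps_one_eq_monom)
  next
    case (insert i S)
    have "mfps_map (\<lambda>p. Finite_Set.fold ?f p (insert i S)) ?E =
        mfps_map (?f i) (mfps_map (\<lambda>p. Finite_Set.fold ?f p S) plane_wave)"
      by (simp add: fold_mpoly_diff_insert insert.hyps mfps_map_map)
    then show ?case
      by (simp add: insert.IH insert.hyps mfps_map_mpoly_diff_power_plane_wave)
  qed
  from this [OF finite_keys] show ?thesis
    unfolding mpoly_diffs_def q_monomial_def .
qed

text \<open>\<open>E\<close> is an eigenvector of every iterated x-derivative, with the matching
  monomial in q as eigenvalue. Summation over the infinitely many monomials of \<open>G\<close> is
  justified at each coefficient \<open>c\<close>, where finitely many of them matter.\<close>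

lemma mfps_map_diff_op_plane_wave:
  fixes G :: "('n::finite, 'a::field_char_0) mfps"
  shows "mfps_map (diff_op G) plane_wave = lift_x (lift_q G) * plane_wave"
proof (rule mfps_eqI)
  fix c :: "'n pvar \<Rightarrow>\<^sub>0 nat"
  let ?E = "mfps_coeff (plane_wave :: (_, ('n, 'a) mpoly) mfps)"
  \<comment> \<open>The exponents whose monomial in q divides \<open>c\<close>; by
    \<open>eq\<close>, all other derivatives of the coefficient at \<open>c\<close> vanish.\<close>
  let ?S = "{a. \<exists>b. q_monomial a + b = c}"
  have eq: "mpoly_diffs a (?E c) = (\<Sum>b | q_monomial a + b = c. ?E b)" for a
    using arg_cong [OF mfps_map_mpoly_diffs_plane_wave [of a], of "\<lambda>f. mfps_coeff f c"]
    by (simp add: mfps_coeff_monom_mult)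
  have "q_monomial ` ?S \<subseteq> {a. \<exists>b. a + b = c}" by auto
  then have "finite (q_monomial ` ?S)"
    using finite_below_monomial finite_subset by blast
  moreover have "inj_on q_monomial ?S" by (metis injI inj_on_subset map_key_q_monomial subset_UNIV)
  ultimately have S: "finite ?S" by (rule finite_imageD)
  have fin: "finite {b. q_monomial a + b = c}" for a
    by (rule finite_subset [OF _ finite_below_monomial [of c]]) (auto simp: add.commute)
  have "mfps_coeff (mfps_map (diff_op G) plane_wave) c =
      (\<Sum>a\<in>?S. mpoly_const (mfps_coeff G a) * (\<Sum>b | q_monomial a + b = c. ?E b))"
    unfolding mfps_coeff_map diff_op_def eq
  proof (rule Sum_any.expand_superset [OF S], clarify)
    fix a assume "mpoly_const (mfps_coeff G a) * (\<Sum>b | q_monomial a + b = c. ?E b) \<noteq> 0"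
    then have "{b. q_monomial a + b = c} \<noteq> {}" by (metis mult_zero_right sum.empty)
    then show "\<exists>b. q_monomial a + b = c" by blast
  qed
  also have "\<dots> = (\<Sum>(a, b)\<in>(SIGMA a:?S. {b. q_monomial a + b = c}). mpoly_const (mfps_coeff G a) * ?E b)"
    by (simp add: sum_distrib_left sum.Sigma S fin)
  \<comment> \<open>The pairs become factorizations of \<open>c\<close> whose first factor is free
    of \<mu>. The remaining factorizations are added afterwards, as \<open>lift_q G\<close> vanishes
    there.\<close>
  also have "\<dots> = (\<Sum>(x, b) | x + b = c \<and> mu_degree x = 0. mfps_coeff (lift_x (lift_q G)) x * ?E b)"
    by (rule sum.reindex_bij_witness [of _ "\<lambda>(x, b). (Poly_Mapping.map_key Q x, b)"
          "\<lambda>(a, b). (q_monomial a, b)"])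
      (auto simp: q_monomial_map_key mfps_coeff_lift_q)
  also have "\<dots> = mfps_coeff (lift_x (lift_q G) * plane_wave) c"
    unfolding mfps_coeff_mult
    by (rule sum.mono_neutral_left [OF finite_split_monomial]) (auto simp: mfps_coeff_lift_q split: if_splits)
  finally show "mfps_coeff (mfps_map (diff_op G) plane_wave) c =
      mfps_coeff (lift_x (lift_q G) * plane_wave) c" .
qed


section \<open>The vector field \<open>\<O>\<close>\<close>

text \<open>The coefficient ring is left general because \<O> is needed both on
  \<open>k[[\<mu>, q]]\<close>, where it moves the \<open>K_j\<close>, and on
  \<open>k[x][[\<mu>, q]]\<close>, where it moves the exponentials.\<close>

definition q_field ::
    "('n::finite \<Rightarrow> ('n pvar, 'a::comm_ring_1) mfps) \<Rightarrow>
      ('n pvar, 'a) mfps \<Rightarrow> ('n pvar, 'a) mfps"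
  where "q_field L g = (\<Sum>i\<in>UNIV. L i * mfps_diff (Q i) g)"

lemma mfps_derivation_q_field: "mfps_derivation (q_field L)"
proof -
  have "mfps_continuous (q_field L)"
    unfolding q_field_def
    by (intro mfps_continuous_finite_sum
        mfps_continuous_compose [OF mfps_continuous_mult mfps_continuous_diff]) simp
  then show ?thesis
    by (simp add: mfps_derivation_def q_field_def mfps_derivation_mult [OF mfps_derivation_diff]
        sum_distrib_left sum_distrib_right sum.distrib algebra_simps)
qed

lemma mfps_continuous_q_field: "mfps_continuous (q_field L)"
  by (rule mfps_derivation_continuous [OF mfps_derivation_q_field])

lemma q_field_mu [simp]: "q_field L mu = 0"
  by (simp add: q_field_def mfps_diff_var)

lemma q_field_mu_power [simp]: "q_field L (mu ^ m) = 0"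
  by (cases m) (simp_all add: mfps_derivation_power [OF mfps_derivation_q_field]
      mfps_derivation_one [OF mfps_derivation_q_field] del: power_Suc)

lemma q_field_const [simp]: "q_field L (mfps_const c) = 0"
  by (simp add: q_field_def)

lemma q_field_scalar [simp]: "q_field L (scalar c) = 0"
  by (simp add: scalar_def)

lemma q_field_x_var [simp]: "q_field L (x_var j) = 0"
  by (simp add: x_var_def)

lemma q_field_q_var [simp]: "q_field L (q_var i) = L i"
  by (simp add: q_field_def mfps_diff_var if_distrib [of "\<lambda>x. _ * x"] cong: if_cong)

lemma q_field_lift_q: "q_field (\<lambda>i. lift_q (F i)) (lift_q g) = lift_q (O_op F g)"
  by (simp add: q_field_def O_op_def mfps_diff_Q_lift_q lift_q_sum lift_q_mult)

lemma q_field_lift_x: "q_field (\<lambda>i. lift_x (L i)) (lift_x g) = lift_x (q_field L g)"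
  by (simp add: q_field_def lift_x_mult lift_x_diff mfps_continuous_sum [OF mfps_continuous_lift_x])

lemma mfps_map_xF_op_plane_wave:
  "mfps_map (xF_op F) plane_wave = q_field (\<lambda>i. lift_x (lift_q (F i))) plane_wave"
proof -
  have "mfps_map (xF_op F) plane_wave = (\<Sum>i\<in>UNIV. x_var i * mfps_map (diff_op (F i)) plane_wave)"
    by (rule mfps_eqI) (simp add: xF_op_def x_var_def)
  then show ?thesis
    by (simp add: q_field_def mfps_map_diff_op_plane_wave mfps_diff_Q_plane_wave mult_ac)
qed

text \<open>The coefficients of the field are constants in x, and the q-derivatives commute with
  every additive map of coefficients.\<close>

lemma mfps_map_q_field_commute:
  assumes add: "\<And>p q. h (p + q) = h p + h q"
    and const: "\<And>c p. h (mpoly_const c * p) = mpoly_const c * h p"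
  shows "mfps_map h (q_field (\<lambda>i. lift_x (L i)) g) =
    q_field (\<lambda>i. lift_x (L i)) (mfps_map h (g :: (_, ('n::finite, 'a::comm_ring_1) mpoly) mfps))"
  by (simp add: q_field_def mfps_continuous_sum [OF mfps_continuous_map, OF add]
      mfps_map_lift_x_mult [OF add const] mfps_map_diff [OF add])

text \<open>The field does not lower the order in \<mu>, whereas integrating the left-hand side
  raises it by one. Hence the order of \<open>G\<close> in \<mu> exceeds every bound.\<close>

lemma ode_unique:
  fixes G :: "('n::finite pvar, ('m, 'a::field_char_0) mpoly) mfps"
  assumes G: "mfps_diff Mu G = q_field L G" and init: "vanishes_below mu_degree 1 G"
  shows "G = 0"
proof -
  have "vanishes_below mu_degree n G" for n
  proof (induction n)
    case (Suc n)
    have "vanishes_below mu_degree n (mfps_diff (Q i) G)" for i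
      using Suc by (simp add: vanishes_below_def mfps_coeff_mfps_diff lookup_add lookup_single)
    then have "vanishes_below mu_degree n (L i * mfps_diff (Q i) G)" for i
      using vanishes_below_mult [where w = mu_degree, OF lookup_add vanishes_below_zero] by (metis add_0)
    then have *: "vanishes_below mu_degree n (mfps_diff Mu G)"
      unfolding G q_field_def by (rule vanishes_below_sum)
    show ?case
      unfolding vanishes_below_def
    proof (intro allI impI)
      fix a :: "'n pvar \<Rightarrow>\<^sub>0 nat" assume a: "mu_degree a < Suc n"
      show "mfps_coeff G a = 0"
      proof (cases "mu_degree a")
        case 0
        then show ?thesis using init by (simp add: vanishes_below_def)
      next
        case (Suc k)
        \<comment> \<open>Removes one factor \<mu>: the coefficient of the \<mu>-derivative at
          \<open>b\<close> is \<open>k + 1\<close> times that of \<open>G\<close> at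
          \<open>a\<close>.\<close>
        define b where "b = a - Poly_Mapping.single Mu 1"
        have b: "a = b + Poly_Mapping.single Mu 1" "mu_degree b = k"
          using Suc by (auto simp: b_def lookup_add lookup_minus lookup_single when_def
              intro!: poly_mapping_eqI)
        have "mfps_coeff (mfps_diff Mu G) b = 0"
          using * a Suc b(2) by (simp add: vanishes_below_def)
        then have "of_nat (k + 1) * mfps_coeff G a = 0"
          by (simp only: mfps_coeff_mfps_diff b(2) flip: b(1))
        \<comment> \<open>The factor \<open>k + 1\<close> is cancelled in the field, one coefficient
          of the polynomial at a time; it is nonzero by characteristic zero.\<close>
        then have "mpoly_const (of_nat (k + 1)) * mfps_coeff G a = 0"
          by (simp only: mpoly_const_of_nat)
        then have "of_nat (k + 1) * Poly_Mapping.lookup (mfps_coeff G a) x = 0" for x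
          by (metis lookup_mpoly_const_mult lookup_zero)
        then show ?thesis
          by (intro poly_mapping_eqI)
            (metis lookup_zero mult_eq_0_iff of_nat_eq_0_iff Suc_eq_plus1 nat.distinct(1))
      qed
    qed
  qed simp
  then show ?thesis
    by (intro mfps_eqI) (auto simp: vanishes_below_def)
qed


section \<open>The evolution equation\<close>

lemma vanishes_below_mu_mult:
  "vanishes_below mu_degree n (f * mu ^ n * (g :: ('n pvar, 'a::comm_ring_1) mfps))"
  using vanishes_below_mult [where w = mu_degree, OF lookup_add vanishes_below_zero [of _ "f * g"]
      vanishes_below_mu_power [of n]]
  by (simp add: mult_ac)

lemma vanishes_below_mu_mult_Suc:
  "vanishes_below mu_degree 1 (f * mu ^ Suc n * (g :: ('n pvar, 'a::comm_ring_1) mfps))"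
  using vanishes_below_mu_mult [of "Suc n" f g] by (simp add: vanishes_below_def del: power_Suc)

lemma locally_finite_mu_series:
  "locally_finite (\<lambda>m. f m * mu ^ m * (g m :: ('n pvar, 'a::comm_ring_1) mfps))"
  by (rule locally_finite_if_vanishes_below [where w = mu_degree]) (rule vanishes_below_mu_mult)

lemma mfps_diff_mu_power:
  "mfps_diff Mu (mu ^ Suc m) = of_nat (Suc m) * (mu ^ m :: ('n pvar, 'a::comm_ring_1) mfps)"
  by (subst mfps_derivation_power [OF mfps_derivation_diff]) (simp add: mfps_diff_var)

lemma q_field_mu_term:
  assumes "q_field L c = 0"
  shows "q_field L (c * mu ^ m * g) = c * mu ^ m * q_field L g"
  by (simp add: mfps_derivation_mult [OF mfps_derivation_q_field] assms)

lemma mfps_diff_mu_term: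
  assumes "mfps_diff Mu c = 0" "mfps_diff Mu g = 0"
  shows "mfps_diff Mu (c * mu ^ Suc m * g) = c * of_nat (Suc m) * mu ^ m * g"
  by (simp add: mfps_derivation_mult [OF mfps_derivation_diff] assms mfps_diff_mu_power mult_ac
      del: power_Suc of_nat_Suc)

text \<open>Common form of \<open>exp (\<mu> A) E\<close> and of \<open>K_i\<close>:
  \<open>c m\<close> is \<open>1/m!\<close>, and \<open>g m\<close> is the \<open>m\<close>-th
  iterate of the operator.\<close>

lemma mu_series_evolution:
  fixes c :: "nat \<Rightarrow> ('n::finite pvar, 'a::comm_ring_1) mfps"
  assumes c: "\<And>m. c (Suc m) * of_nat (Suc m) = c m"
    and const: "\<And>m. mfps_diff Mu (c m) = 0" "\<And>m. q_field L (c m) = 0"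
    and g: "\<And>m. mfps_diff Mu (g m) = 0" "\<And>m. q_field L (g m) = g (Suc m)"
  shows "mfps_diff Mu (mfps_suminf (\<lambda>m. c m * mu ^ m * g m)) =
    q_field L (mfps_suminf (\<lambda>m. c m * mu ^ m * g m))"
proof -
  let ?t = "\<lambda>m. c m * mu ^ m * g m"
  have t: "locally_finite ?t" by (rule locally_finite_mu_series)
  have "mfps_diff Mu (mfps_suminf ?t) = mfps_suminf (\<lambda>m. mfps_diff Mu (?t m))"
    by (rule mfps_continuous_suminf [OF mfps_continuous_diff t])
  also have "\<dots> = mfps_diff Mu (?t 0) + mfps_suminf (\<lambda>m. mfps_diff Mu (?t (Suc m)))"
    by (rule mfps_suminf_Suc) (rule mfps_continuous_suminf [OF mfps_continuous_diff t])
  \<comment> \<open>Term \<open>Suc m\<close> on the left meets term \<open>m\<close> on the right: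
    both equal \<open>c m * mu ^ m * g (Suc m)\<close>. Term 0 is independent of \<mu>.\<close>
  also have "\<dots> = mfps_suminf (\<lambda>m. q_field L (?t m))"
    unfolding mfps_diff_mu_term [OF const(1) g(1)] q_field_mu_term [OF const(2)] c g(2)
    by (simp add: mfps_derivation_mult [OF mfps_derivation_diff] const g)
  also have "\<dots> = q_field L (mfps_suminf ?t)"
    by (rule mfps_continuous_suminf(2) [OF mfps_continuous_q_field t, symmetric])
  finally show ?thesis .
qed

lemma exp_mu_op_evolution:
  fixes F :: "'n::finite \<Rightarrow> ('n, 'a::field_char_0) mfps"
  shows "mfps_diff Mu (exp_mu_op (xF_op F) plane_wave) =
    q_field (\<lambda>i. lift_x (lift_q (F i))) (exp_mu_op (xF_op F) plane_wave)"
proof -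
  let ?A = "mfps_map (xF_op F) :: ('n pvar, ('n, 'a) mpoly) mfps \<Rightarrow> _"
  let ?B = "q_field (\<lambda>i. lift_x (lift_q (F i)))"
  have "mfps_diff Mu ((?A ^^ m) plane_wave) = 0" for m
  proof (induction m)
    case (Suc m)
    then show ?case
      using mfps_continuous_zero [OF mfps_continuous_map [OF xF_op_add [of F]]]
      by (simp add: mfps_map_diff [OF xF_op_add, symmetric])
  qed (simp add: mfps_diff_Mu_plane_wave)
  \<comment> \<open>\<open>?B\<close> moves past the powers of \<open>?A\<close> to reach
    \<open>plane_wave\<close>, where it agrees with \<open>?A\<close>.\<close>
  moreover have "?B ((?A ^^ m) plane_wave) = (?A ^^ Suc m) plane_wave" for m
    by (induction m)
      (simp_all add: mfps_map_xF_op_plane_wave mfps_map_q_field_commute [OF xF_op_add xF_op_const_mult, symmetric])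
  ultimately show ?thesis
    unfolding exp_mu_op_def
    by (intro mu_series_evolution) (simp_all add: scalar_inverse_fact_Suc del: fact_Suc of_nat_Suc)
qed

section \<open>Values at \<mu> = 0\<close>

lemma exp_mu_op_initial:
  "vanishes_below mu_degree 1 (exp_mu_op A f - f)"
proof -
  let ?t = "\<lambda>m. scalar (1 / fact m) * mu ^ m * (mfps_map A ^^ m) f"
  have "exp_mu_op A f = ?t 0 + mfps_suminf (\<lambda>m. ?t (Suc m))"
    unfolding exp_mu_op_def by (rule mfps_suminf_Suc) (rule locally_finite_mu_series)
  then have "exp_mu_op A f - f = mfps_suminf (\<lambda>m. ?t (Suc m))" by simp
  also have "vanishes_below mu_degree 1 \<dots>"
  proof (rule vanishes_below_suminf)
    show "vanishes_below mu_degree 1 (?t (Suc m))" for m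
      by (rule vanishes_below_mu_mult_Suc)
  qed
  finally show ?thesis .
qed

text \<open>\<open>f ^ m - g ^ m\<close> is a multiple of \<open>f - g\<close>, so all powers agree
  at \<mu> = 0.\<close>

lemma mfps_exp_initial:
  assumes "vanishes_below mu_degree 1 (f - g)"
  shows "vanishes_below mu_degree 1 (mfps_exp f - mfps_exp g)"
proof -
  have "vanishes_below mu_degree 1 (f ^ m - g ^ m)" for m
  proof -
    have "vanishes_below mu_degree (1 + 0) ((f - g) * (\<Sum>i<m. g ^ (m - Suc i) * f ^ i))"
      by (rule vanishes_below_mult [OF lookup_add assms vanishes_below_zero])
    then show ?thesis by (simp add: power_diff_sumr2)
  qed
  then have "mfps_coeff (f ^ m) a = mfps_coeff (g ^ m) a" if "mu_degree a = 0" for m a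
    using that by (simp add: vanishes_below_def)
  then show ?thesis
    by (simp add: vanishes_below_def mfps_exp_def mfps_coeff_suminf scalar_def)
qed

text \<open>The claimed formula, taken as a candidate: once it is known to be a solution, uniqueness
  identifies every solution with it.\<close>

definition K_series :: "('n::finite \<Rightarrow> ('n, 'a::field_char_0) mfps) \<Rightarrow> 'n \<Rightarrow> ('n pvar, 'a) mfps"
  where "K_series F i = q_var i + expm1_div_op (O_op F) (F i)"

lemma expm1_div_op_vanishes: "vanishes_below mu_degree 1 (expm1_div_op T g)"
  unfolding expm1_div_op_def
proof (rule vanishes_below_suminf)
  show "vanishes_below mu_degree 1 (mfps_const (1 / fact (Suc l)) * mu ^ Suc l * lift_q ((T ^^ l) g))" for l
    by (rule vanishes_below_mu_mult_Suc)
qed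

text \<open>Including \<open>q\<^sub>i\<close> as the term of index zero makes \<open>K\<^sub>i\<close> the single series
  \<open>\<Sum>\<^sub>m \<mu>\<^sup>m/m! \<O>\<^sup>m q\<^sub>i\<close>, since \<open>\<O> q\<^sub>i = F\<^sub>i\<close>.\<close>

lemma K_series_eq_exp:
  "K_series F i = mfps_suminf (\<lambda>m. mfps_const (1 / fact m) * mu ^ m *
    (case m of 0 \<Rightarrow> q_var i | Suc l \<Rightarrow> lift_q ((O_op F ^^ l) (F i))))"
  by (subst mfps_suminf_Suc [OF locally_finite_mu_series])
    (simp add: K_series_def expm1_div_op_def)

text \<open>At index 0 the recursion for the iterates is \<open>\<O> q_i = F_i\<close>; from index 1
  on it is the iteration of \<open>O_op F\<close>.\<close>

lemma K_series_evolution: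
  "mfps_diff Mu (K_series F i) = q_field (\<lambda>i. lift_q (F i)) (K_series F i)"
  unfolding K_series_eq_exp
  by (rule mu_series_evolution)
    (auto simp: mfps_const_inverse_fact_Suc mfps_diff_var mfps_diff_Mu_lift_q q_field_lift_q
      split: nat.split simp del: fact_Suc of_nat_Suc)

lemma mfps_coeff_0_K_series: "mfps_coeff (K_series F i) 0 = 0"
  using expm1_div_op_vanishes [of "O_op F" "F i"]
  by (simp add: K_series_def vanishes_below_def)

lemma determines_K_series:
  fixes F :: "'n::finite \<Rightarrow> ('n, 'a::field_char_0) mfps"
  shows "determines_K F (K_series F)"
proof -
  let ?f = "\<Sum>j\<in>UNIV. lift_x (K_series F j) * x_var j"
  let ?B = "q_field (\<lambda>i. lift_x (lift_q (F i)))"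
  let ?R = "exp_mu_op (xF_op F) plane_wave"
  have f0: "mfps_coeff ?f 0 = 0"
    by (simp add: mfps_coeff_0_mult mfps_coeff_0_K_series)
  \<comment> \<open>Both derivations kill the \<open>x_var j\<close> and pass through
    \<open>lift_x\<close>, so the equation for the \<open>K_j\<close> carries over to the linear
    form.\<close>
  have "mfps_diff Mu ?f = ?B ?f"
    by (simp add: mfps_continuous_sum [OF mfps_continuous_diff] mfps_continuous_sum [OF mfps_continuous_q_field]
        mfps_derivation_mult [OF mfps_derivation_diff] mfps_derivation_mult [OF mfps_derivation_q_field]
        K_series_evolution q_field_lift_x flip: lift_x_diff)
  \<comment> \<open>Both sides are the same multiple of \<open>mfps_exp ?f\<close> by the chain
    rule.\<close>
  then have evolution: "mfps_diff Mu (mfps_exp ?f) = ?B (mfps_exp ?f)"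
    by (simp add: mfps_derivation_exp [OF mfps_derivation_diff _ f0]
        mfps_derivation_exp [OF mfps_derivation_q_field _ f0])
  have "?f - (\<Sum>j\<in>UNIV. q_var j * x_var j) =
      (\<Sum>j\<in>UNIV. lift_x (expm1_div_op (O_op F) (F j)) * x_var j)"
    by (simp add: K_series_def mfps_continuous_add [OF mfps_continuous_lift_x] lift_x_var
        distrib_right sum.distrib)
  also have "vanishes_below mu_degree 1 \<dots>"
  proof (rule vanishes_below_sum)
    fix j
    have "vanishes_below mu_degree 1 (lift_x (expm1_div_op (O_op F) (F j)))"
      using expm1_div_op_vanishes [of "O_op F" "F j"] by (simp add: vanishes_below_def)
    from vanishes_below_mult [where w = mu_degree, OF lookup_add this vanishes_below_zero]
    show "vanishes_below mu_degree 1 (lift_x (expm1_div_op (O_op F) (F j)) * x_var j)" by simp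
  qed
  finally have init: "vanishes_below mu_degree 1 (mfps_exp ?f - plane_wave)"
    unfolding plane_wave_def by (rule mfps_exp_initial)
  have "mfps_exp ?f - ?R = 0"
  proof (rule ode_unique)
    have diff: "T (f - g) = T f - T g" if "mfps_continuous T"
      for T :: "('n pvar, ('n, 'a) mpoly) mfps \<Rightarrow> ('n pvar, ('n, 'a) mpoly) mfps"
        and f g
      using mfps_continuous_add [OF that, of "f - g" g] by simp
    show "mfps_diff Mu (mfps_exp ?f - ?R) = ?B (mfps_exp ?f - ?R)"
      by (simp add: diff mfps_continuous_diff mfps_continuous_q_field evolution exp_mu_op_evolution)
    show "vanishes_below mu_degree 1 (mfps_exp ?f - ?R)"
      using init exp_mu_op_initial [of "xF_op F" plane_wave] by (simp add: vanishes_below_def)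
  qed
  then show ?thesis
    by (simp add: determines_K_def mfps_coeff_0_K_series plane_wave_def)
qed


section \<open>Uniqueness\<close>

text \<open>The degree is taken in x alone, whatever the monomial in \<mu> and q; zero is
  homogeneous of every degree.\<close>

definition homogeneous :: "nat \<Rightarrow> ('v, ('n, 'a::zero) mpoly) mfps \<Rightarrow> bool"
  where "homogeneous m f \<longleftrightarrow>
    (\<forall>a b. Poly_Mapping.lookup (mfps_coeff f a) b \<noteq> 0 \<longrightarrow> mdegree b = m)"

lemma homogeneous_mult:
  fixes f g :: "('v, ('n, 'a::comm_ring_1) mpoly) mfps"
  assumes f: "homogeneous m f" and g: "homogeneous n g"
  shows "homogeneous (m + n) (f * g)"
  unfolding homogeneous_def
proof (intro allI impI)
  fix c e
  assume "Poly_Mapping.lookup (mfps_coeff (f * g) c) e \<noteq> 0"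
  then obtain a b where "Poly_Mapping.lookup (mfps_coeff f a * mfps_coeff g b) e \<noteq> 0"
    unfolding mfps_coeff_mult lookup_sum by (auto elim!: sum.not_neutral_contains_not_neutral)
  then obtain x y where "e = x + y"
    "x \<in> Poly_Mapping.keys (mfps_coeff f a)" "y \<in> Poly_Mapping.keys (mfps_coeff g b)"
    using keys_mult [of "mfps_coeff f a" "mfps_coeff g b"] by (auto simp: in_keys_iff)
  then show "mdegree e = m + n"
    using f g by (simp add: homogeneous_def in_keys_iff mdegree_add)
qed

lemma homogeneous_power:
  fixes f :: "('v, ('n, 'a::comm_ring_1) mpoly) mfps"
  assumes f: "homogeneous 1 f"
  shows "homogeneous m (f ^ m)"
proof (induction m)
  case 0
  show ?case
    by (auto simp: homogeneous_def mfps_coeff_one mdegree_eq_0_iff lookup_one when_def split: if_splits)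
next
  case (Suc m)
  from homogeneous_mult [OF f this] show ?case by simp
qed

lemma mfps_coeff_linear_form:
  "mfps_coeff (\<Sum>j\<in>UNIV. lift_x (K j) * x_var j) a =
    (\<Sum>j\<in>UNIV. mpoly_const (mfps_coeff (K j) a) * mpoly_var (j :: 'n::finite) :: ('n, 'a::comm_ring_1) mpoly)"
  by (simp add: x_var_def mult.commute [of _ "mfps_const _"] mult.commute [of "mpoly_var _"])

lemma lookup_linear_form:
  "Poly_Mapping.lookup (mfps_coeff (\<Sum>j\<in>UNIV. lift_x (K j) * x_var (j :: 'n::finite)) a) b =
    (\<Sum>j\<in>UNIV. if b = Poly_Mapping.single j 1 then mfps_coeff (K j) a else (0 :: 'a::comm_ring_1))"
  unfolding mfps_coeff_linear_form lookup_sum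
  by (intro sum.cong) (auto simp: mpoly_var_def lookup_single when_def)

lemma homogeneous_linear_form:
  "homogeneous 1 (\<Sum>j\<in>UNIV. lift_x (K j :: ('n::finite pvar, 'a::comm_ring_1) mfps) * x_var j)"
  unfolding homogeneous_def lookup_linear_form
  by (auto elim!: sum.not_neutral_contains_not_neutral split: if_splits)

text \<open>The \<open>m\<close>-th term of the exponential is homogeneous of degree
  \<open>m\<close> in x, so the monomial \<open>x_i\<close> can come only from the linear
  term.\<close>

lemma lookup_exp_linear_form:
  fixes K :: "'n::finite \<Rightarrow> ('n pvar, 'a::field_char_0) mfps"
  assumes "\<And>j. mfps_coeff (K j) 0 = 0"
  shows "Poly_Mapping.lookup (mfps_coeff (mfps_exp (\<Sum>j\<in>UNIV. lift_x (K j) * x_var j)) a)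
    (Poly_Mapping.single i 1) = mfps_coeff (K i) a"
proof -
  let ?f = "\<Sum>j\<in>UNIV. lift_x (K j) * x_var j"
  let ?t = "\<lambda>m. scalar (1 / fact m) * ?f ^ m"
  \<comment> \<open>Index 1 is inserted because its term may vanish at \<open>a\<close>, while the
    sum is about to be reduced to it.\<close>
  let ?M = "insert 1 {m. mfps_coeff (?t m) a \<noteq> 0}"
  have "mfps_coeff ?f 0 = 0" using assms by (simp add: mfps_coeff_0_mult)
  then have "finite ?M" using locally_finite_exp [of ?f] by (simp add: locally_finite_def)
  have zero: "Poly_Mapping.lookup (mfps_coeff (?t m) a) (Poly_Mapping.single i 1) = 0" if "m \<noteq> 1" for m
    using homogeneous_power [OF homogeneous_linear_form [of K], of m] that
    unfolding homogeneous_def by (force simp: scalar_def)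
  have "Poly_Mapping.lookup (mfps_coeff (mfps_exp ?f) a) (Poly_Mapping.single i 1) =
      (\<Sum>m\<in>?M. Poly_Mapping.lookup (mfps_coeff (?t m) a) (Poly_Mapping.single i 1))"
    unfolding mfps_exp_def
    by (subst mfps_coeff_suminf_superset [OF \<open>finite ?M\<close>]) (auto simp: lookup_sum)
  also have "\<dots> = (\<Sum>m\<in>{1}. Poly_Mapping.lookup (mfps_coeff (?t m) a) (Poly_Mapping.single i 1))"
    by (rule sum.mono_neutral_right [OF \<open>finite ?M\<close>]) (use zero in auto)
  also have "\<dots> = Poly_Mapping.lookup (mfps_coeff ?f a) (Poly_Mapping.single i 1)"
    by simp
  also have "\<dots> = (\<Sum>j\<in>UNIV. if j = i then mfps_coeff (K j) a else 0)"
    \<comment> \<open>Comparing keys shows that equal monomials \<open>x_i\<close> and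
      \<open>x_j\<close> have \<open>i = j\<close>.\<close>
    unfolding lookup_linear_form by (intro sum.cong) (auto dest: arg_cong [where f = Poly_Mapping.keys])
  finally show ?thesis by simp
qed

text \<open>Both exponentials equal the same right-hand side, whose coefficients at the
  \<open>x_i\<close> recover the series.\<close>

lemma determines_K_unique:
  assumes "determines_K F K" "determines_K F K'"
  shows "K = K'"
proof (intro ext mfps_eqI)
  show "mfps_coeff (K i) a = mfps_coeff (K' i) a" for i a
    using assms lookup_exp_linear_form [of K a i] lookup_exp_linear_form [of K' a i]
    by (simp add: determines_K_def)
qed

theorem mainTheorem8:
  fixes F :: "'n::finite \<Rightarrow> ('n, 'a::field_char_0) mfps"
  shows "(\<exists>!K. determines_K F K) \<and>
    (\<forall>K. determines_K F K \<longrightarrow> (\<forall>i. K i = q_var i + expm1_div_op (O_op F) (F i)))"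
  using determines_K_series [of F] determines_K_unique [of F] by (metis K_series_def)

end
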